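(* Let $T>0$, $x_0\in\mathbb{R}^d$, let $S_T\subseteq\mathbb{R}^d$ and $U\subseteq L^m_q(0,T)$ ($1\le q\le+\infty$) be closed sets, $\theta\colon\mathbb{R}^d\times[0,T]\to\mathbb{R}$, $\zeta\colon\mathbb{R}^d\to\mathbb{R}$, $f\colon\mathbb{R}^d\times\mathbb{R}^m\times[0,T]\to\mathbb{R}^d$, $g_j\colon\mathbb{R}^d\times[0,T]\to\mathbb{R}$, $j\in J=\{1,\dots,l\}$, and consider $$\min\ \mathcal{I}(x)=\int_0^T\theta(x(t),t)\,dt+\zeta(x(T))\quad\text{subject to}\quad\dot x(t)=f(x(t),u(t),t),\ t\in[0,T],$$ $$x(0)=x_0,\ x(T)\in S_T,\ u\in U,\quad g_j(x(t),t)\le0\ \ \forall t\in[0,T],\ j\in J.\qquad(\ast)$$ Let $p\in(1,+\infty]$, let $$X=\Big\{x\in(C[0,T])^d\Bigm|\exists u\in U\colon x(t)=x_0+\int_0^tf(x(\tau),u(\tau),\tau)\,d\tau\ \ \forall t\in[0,T]\Big\}$$ be equipped with the metric $d_X(x,y)=\|x-y\|_p+|x(T)-y(T)|$, let $A=\{x\in X\mid x(T)\in S_T\}$, $\Omega=\{x\in A\mid g_j(x(t),t)\le0\ \forall t\in[0,T],\,j\in J\}$, $\phi(x,t)=\max\{g_1(x,t),\dots,g_l(x,t),0\}$, $\varphi(x)=\|\phi(x(\cdot),\cdot)\|_p$ and $\Phi_\lambda(x)=\mathcal{I}(x)+\lambda\varphi(x)$ for $x\in X$. Suppose that: 1. $\zeta$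 is locally Lipschitz continuous, $\theta$ and $g_j$, $j\in J$, are continuous and differentiable in $x$, and the functions $\nabla_x\theta$ and $\nabla_xg_j$, $j\in J$, are continuous; 2. the set $X$ is compact in $(C[0,T])^d$, and there exists a feasible point of $(\ast)$; 3. there exist $a>0$ and $\eta>0$ such that for any $x\in A\setminus\Omega$ one can find a sequence of trajectories $\{x_n\}\subseteq A$ converging to $x$ in the space $X$ such that $|x_n(T)-x(T)|\le\eta\|x_n-x\|_p$ for all $n\in\mathbb{N}$, the sequence $\{(x_n-x)/\|x_n-x\|_p\}$ converges to some $h$ in $L^d_p(0,T)$, and $$\int_0^T\phi(x(t),t)^{p-1}\max_{v\in\partial_x\phi(x(t),t)}\langle v,h(t)\rangle\,dt\le-a\,\varphi(x)^{p-1}$$ in the case $1<p<+\infty$, while $$\langle\nabla_xg_j(x(t),t),h(t)\rangle\le-a\quad\forall t\in[0,T],\ j\in J\colon\ \varphi(x)=g_j(x(t),t)$$ in the case $p=+\infty$. Then the penalty function $\Phi_\lambda$ for problem $(\ast)$ is completely exact on $A$.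
   Context: $L^m_q(0,T)$ is the product of $m$ copies of $L^q(0,T)$; $\|\cdot\|_p$ is the $L^p(0,T)$ norm of vector-valued functions (Euclidean norm pointwise); $(C[0,T])^d$ carries the uniform norm. In assumption 3, $x_n\ne x$; in the case $p=+\infty$ the limit $h$ is identified with its continuous representative. Subdifferential: put $g_0(x,t)\equiv0$, $J(x,t)=\{j\in J\cup\{0\}\mid\phi(x,t)=g_j(x,t)\}$ and $\partial_x\phi(x,t)=\operatorname{co}\{\nabla_xg_j(x,t)\mid j\in J(x,t)\}$ (convex hull). Problem $(\ast)$ is viewed as $\min_{x\in\Omega}\mathcal{I}(x)$, and the penalised problem is $\min_{x\in A}\Phi_\lambda(x)$, both in the metric space $(X,d_X)$; local optimality and inf-stationarity are with respect to $d_X$. For $K\subseteq X$, $F\colon X\to\mathbb{R}$ and $z\in K$, $F^{\downarrow}_K(z)=\liminf_{y\to z,\,y\in K}\frac{F(y)-F(z)}{d_X(y,z)}$ ($+\infty$ if $z$ is isolated in $K$); $z$ is an inf-stationary point of $F$ on $K$ if $F^{\downarrow}_K(z)\ge0$. "$\Phi_\lambda$ is completely exact on $A$" means: there exists $\lambda^*\ge0$ such that for every $\lambda\ge\lambda^*$: (1) the optimal values of $\min_\Omega\mathcal{I}$ and $\min_A\Phi_\lambda$ coincide; (2) their globally optimal solutions coincide; (3) $z\in A$ is a locally optimal solution of $\min_A\Phi_\lambda$ iff $z\in\Omega$ and $z$ is a locally optimal solution of $\min_\Omega\mathcal{I}$; (4) $z\in A$ is an inf-stationary point of $\Phi_\lambda$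 on $A$ iff $z\in\Omega$ and $z$ is an inf-stationary point of $\mathcal{I}$ on $\Omega$. *)

theory Defs
  imports "HOL-Analysis.Analysis" "HOL-Probability.Essential_Supremum"
begin

section \<open>The spaces \<open>L\<^sup>p(0,T)\<close>\<close>

text \<open>
  Elements of \<open>L\<^sup>p(0,T)\<close>, \<open>1 \<le> p \<le> \<infinity>\<close>, are represented by functions, not by classes modulo
  equality almost everywhere; only the values on \<open>[0,T]\<close> matter.
\<close>

definition Lp_space :: "ereal \<Rightarrow> real \<Rightarrow> (real \<Rightarrow> 'b::euclidean_space) set" where
  "Lp_space p T = {y \<in> borel_measurable (lebesgue_on {0..T}).
     if p = \<infinity> then esssup (lebesgue_on {0..T}) (\<lambda>t. ereal (norm (y t))) < \<infinity>
     else integrable (lebesgue_on {0..T}) (\<lambda>t. norm (y t) powr real_of_ereal p)}"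

definition Lp_norm :: "ereal \<Rightarrow> real \<Rightarrow> (real \<Rightarrow> 'b::euclidean_space) \<Rightarrow> real" where
  "Lp_norm p T y =
     (if p = \<infinity> then real_of_ereal (esssup (lebesgue_on {0..T}) (\<lambda>t. ereal (norm (y t))))
      else (LINT t|lebesgue_on {0..T}. norm (y t) powr real_of_ereal p) powr (1 / real_of_ereal p))"

definition Lp_tendsto :: "ereal \<Rightarrow> real \<Rightarrow> (nat \<Rightarrow> real \<Rightarrow> 'b::euclidean_space) \<Rightarrow> (real \<Rightarrow> 'b) \<Rightarrow> bool" where
  "Lp_tendsto p T y h \<longleftrightarrow> (\<forall>n. y n \<in> Lp_space p T) \<and> h \<in> Lp_space p T
     \<and> (\<lambda>n. Lp_norm p T (\<lambda>t. y n t - h t)) \<longlonglongrightarrow> 0"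

text \<open>
  Sequential closedness.  Constant sequences show that such a set is invariant under changes on
  null sets, so these sets are exactly the preimages of the closed subsets of the quotient space.
\<close>

definition Lp_closed :: "ereal \<Rightarrow> real \<Rightarrow> (real \<Rightarrow> 'b::euclidean_space) set \<Rightarrow> bool" where
  "Lp_closed p T U \<longleftrightarrow> U \<subseteq> Lp_space p T
     \<and> (\<forall>u v. (\<forall>n. u n \<in> U) \<and> Lp_tendsto p T u v \<longrightarrow> v \<in> U)"


section \<open>Gradients\<close>

definition gradient :: "('a::real_inner \<Rightarrow> real) \<Rightarrow> 'a \<Rightarrow> 'a" where
  "gradient F x = (THE v. GDERIV F x :> v)"

definition C1_in_state :: "real \<Rightarrow> ('a::euclidean_space \<Rightarrow> real \<Rightarrow> real) \<Rightarrow> bool" where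
  "C1_in_state T F \<longleftrightarrow>
     continuous_on (UNIV \<times> {0..T}) (\<lambda>(x, t). F x t)
   \<and> (\<forall>x. \<forall>t\<in>{0..T}. (\<lambda>y. F y t) differentiable (at x))
   \<and> continuous_on (UNIV \<times> {0..T}) (\<lambda>(x, t). gradient (\<lambda>y. F y t) x)"

definition locally_Lipschitz :: "('a::metric_space \<Rightarrow> 'b::metric_space) \<Rightarrow> bool" where
  "locally_Lipschitz F \<longleftrightarrow> (\<forall>x. \<exists>r>0. \<exists>L. L-lipschitz_on (ball x r) F)"


section \<open>Optimality, inf-stationarity and complete exactness\<close>

text \<open>In this section \<open>d\<close> is the metric of the ambient space.\<close>

definition globally_optimal :: "'x set \<Rightarrow> ('x \<Rightarrow> real) \<Rightarrow> 'x \<Rightarrow> bool" where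
  "globally_optimal K F z \<longleftrightarrow> z \<in> K \<and> (\<forall>y\<in>K. F z \<le> F y)"

definition locally_optimal :: "('x \<Rightarrow> 'x \<Rightarrow> real) \<Rightarrow> 'x set \<Rightarrow> ('x \<Rightarrow> real) \<Rightarrow> 'x \<Rightarrow> bool" where
  "locally_optimal d K F z \<longleftrightarrow> z \<in> K \<and> (\<exists>r>0. \<forall>y\<in>K. d y z < r \<longrightarrow> F z \<le> F y)"

text \<open>
  The filter is the one of punctured neighbourhoods of \<open>z\<close> in \<open>K\<close> for \<open>d\<close>.  If \<open>z\<close> is isolated
  in \<open>K\<close>, it is \<open>bot\<close> and the value is \<open>\<infinity>\<close>.
\<close>

definition steepest_descent_rate ::
    "('x \<Rightarrow> 'x \<Rightarrow> real) \<Rightarrow> 'x set \<Rightarrow> ('x \<Rightarrow> real) \<Rightarrow> 'x \<Rightarrow> ereal" where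
  "steepest_descent_rate d K F z =
     Liminf (INF r\<in>{0<..}. principal {y \<in> K. y \<noteq> z \<and> d y z < r})
       (\<lambda>y. ereal ((F y - F z) / d y z))"

definition inf_stationary :: "('x \<Rightarrow> 'x \<Rightarrow> real) \<Rightarrow> 'x set \<Rightarrow> ('x \<Rightarrow> real) \<Rightarrow> 'x \<Rightarrow> bool" where
  "inf_stationary d K F z \<longleftrightarrow> z \<in> K \<and> steepest_descent_rate d K F z \<ge> 0"

definition completely_exact ::
    "('x \<Rightarrow> 'x \<Rightarrow> real) \<Rightarrow> 'x set \<Rightarrow> 'x set \<Rightarrow> ('x \<Rightarrow> real) \<Rightarrow> (real \<Rightarrow> 'x \<Rightarrow> real) \<Rightarrow> bool" where
  "completely_exact d A \<Omega> I \<Phi> \<longleftrightarrow>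
     (\<exists>c0\<ge>0. \<forall>c\<ge>c0.
        (INF x\<in>\<Omega>. ereal (I x)) = (INF x\<in>A. ereal (\<Phi> c x))
      \<and> {z. globally_optimal \<Omega> I z} = {z. globally_optimal A (\<Phi> c) z}
      \<and> (\<forall>z\<in>A. locally_optimal d A (\<Phi> c) z \<longleftrightarrow> z \<in> \<Omega> \<and> locally_optimal d \<Omega> I z)
      \<and> (\<forall>z\<in>A. inf_stationary d A (\<Phi> c) z \<longleftrightarrow> z \<in> \<Omega> \<and> inf_stationary d \<Omega> I z))"


section \<open>The optimal control problem\<close>

text \<open>
  The metric space of continuous functions on \<open>[0,T]\<close> with the uniform distance.  Its points are
  functions that are \<open>undefined\<close> outside \<open>[0,T]\<close>, so that equality is equality on \<open>[0,T]\<close>.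
\<close>

definition C_space :: "real \<Rightarrow> (real \<Rightarrow> 'a::euclidean_space) metric" where
  "C_space T = cfunspace (top_of_set {0..T}) euclidean_metric"

text \<open>
  No regularity of \<open>f\<close> is assumed, so the existence of the integral (in the sense of Lebesgue) is
  part of the requirement on a trajectory.
\<close>

definition trajectories ::
    "real \<Rightarrow> real^'d \<Rightarrow> (real^'d \<Rightarrow> real^'m \<Rightarrow> real \<Rightarrow> real^'d) \<Rightarrow> (real \<Rightarrow> real^'m) set
      \<Rightarrow> (real \<Rightarrow> real^'d) set" where
  "trajectories T x0 f U =
     {x \<in> mspace (C_space T). \<exists>u\<in>U.
        set_integrable lebesgue {0..T} (\<lambda>\<tau>. f (x \<tau>) (u \<tau>) \<tau>)
      \<and> (\<forall>t\<in>{0..T}. x t = x0 + (LINT \<tau>:{0..t}|lebesgue. f (x \<tau>) (u \<tau>) \<tau>))}"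

definition dist_X :: "ereal \<Rightarrow> real \<Rightarrow> (real \<Rightarrow> real^'d) \<Rightarrow> (real \<Rightarrow> real^'d) \<Rightarrow> real" where
  "dist_X p T x y = Lp_norm p T (\<lambda>t. x t - y t) + norm (x T - y T)"

definition admissible ::
    "real \<Rightarrow> real^'d \<Rightarrow> (real^'d \<Rightarrow> real^'m \<Rightarrow> real \<Rightarrow> real^'d) \<Rightarrow> (real \<Rightarrow> real^'m) set
      \<Rightarrow> (real^'d) set \<Rightarrow> (real \<Rightarrow> real^'d) set" where
  "admissible T x0 f U S = {x \<in> trajectories T x0 f U. x T \<in> S}"

definition feasible ::
    "real \<Rightarrow> real^'d \<Rightarrow> (real^'d \<Rightarrow> real^'m \<Rightarrow> real \<Rightarrow> real^'d) \<Rightarrow> (real \<Rightarrow> real^'m) set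
      \<Rightarrow> (real^'d) set \<Rightarrow> nat \<Rightarrow> (nat \<Rightarrow> real^'d \<Rightarrow> real \<Rightarrow> real) \<Rightarrow> (real \<Rightarrow> real^'d) set" where
  "feasible T x0 f U S l g =
     {x \<in> admissible T x0 f U S. \<forall>t\<in>{0..T}. \<forall>j\<in>{1..l}. g j (x t) t \<le> 0}"

definition cost ::
    "real \<Rightarrow> (real^'d \<Rightarrow> real \<Rightarrow> real) \<Rightarrow> (real^'d \<Rightarrow> real) \<Rightarrow> (real \<Rightarrow> real^'d) \<Rightarrow> real" where
  "cost T \<theta> \<zeta> x = (LINT t:{0..T}|lebesgue. \<theta> (x t) t) + \<zeta> (x T)"

definition max_constraint ::
    "nat \<Rightarrow> (nat \<Rightarrow> real^'d \<Rightarrow> real \<Rightarrow> real) \<Rightarrow> real^'d \<Rightarrow> real \<Rightarrow> real" where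
  "max_constraint l g x t = Max (insert 0 ((\<lambda>j. g j x t) ` {1..l}))"

definition with_zero ::
    "(nat \<Rightarrow> real^'d \<Rightarrow> real \<Rightarrow> real) \<Rightarrow> nat \<Rightarrow> real^'d \<Rightarrow> real \<Rightarrow> real" where
  "with_zero g j x t = (if j = 0 then 0 else g j x t)"

definition active_set ::
    "nat \<Rightarrow> (nat \<Rightarrow> real^'d \<Rightarrow> real \<Rightarrow> real) \<Rightarrow> real^'d \<Rightarrow> real \<Rightarrow> nat set" where
  "active_set l g x t = {j \<in> {0..l}. max_constraint l g x t = with_zero g j x t}"

definition subdiff ::
    "nat \<Rightarrow> (nat \<Rightarrow> real^'d \<Rightarrow> real \<Rightarrow> real) \<Rightarrow> real^'d \<Rightarrow> real \<Rightarrow> (real^'d) set" where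
  "subdiff l g x t =
     convex hull ((\<lambda>j. gradient (\<lambda>y. with_zero g j y t) x) ` active_set l g x t)"

definition penalty_term ::
    "ereal \<Rightarrow> real \<Rightarrow> nat \<Rightarrow> (nat \<Rightarrow> real^'d \<Rightarrow> real \<Rightarrow> real) \<Rightarrow> (real \<Rightarrow> real^'d) \<Rightarrow> real" where
  "penalty_term p T l g x = Lp_norm p T (\<lambda>t. max_constraint l g (x t) t)"

definition penalty_fun ::
    "ereal \<Rightarrow> real \<Rightarrow> (real^'d \<Rightarrow> real \<Rightarrow> real) \<Rightarrow> (real^'d \<Rightarrow> real) \<Rightarrow> nat
      \<Rightarrow> (nat \<Rightarrow> real^'d \<Rightarrow> real \<Rightarrow> real) \<Rightarrow> real \<Rightarrow> (real \<Rightarrow> real^'d) \<Rightarrow> real" where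
  "penalty_fun p T \<theta> \<zeta> l g c x = cost T \<theta> \<zeta> x + c * penalty_term p T l g x"

text \<open>
  The bound on the derivative of the penalty term at \<open>x\<close> in the direction \<open>h\<close>.  The supremum is
  a maximum, as the subdifferential is nonempty and compact.  For \<open>p = \<infinity>\<close> the condition is
  pointwise, and \<open>h\<close>, a uniform limit of continuous functions, has to be the continuous
  representative of its class.
\<close>

definition descent_condition ::
    "ereal \<Rightarrow> real \<Rightarrow> nat \<Rightarrow> (nat \<Rightarrow> real^'d \<Rightarrow> real \<Rightarrow> real) \<Rightarrow> real
      \<Rightarrow> (real \<Rightarrow> real^'d) \<Rightarrow> (real \<Rightarrow> real^'d) \<Rightarrow> bool" where
  "descent_condition p T l g a x h \<longleftrightarrow>
     (if p = \<infinity> then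
        continuous_on {0..T} h
      \<and> (\<forall>t\<in>{0..T}. \<forall>j\<in>{1..l}. penalty_term p T l g x = g j (x t) t \<longrightarrow>
           gradient (\<lambda>y. g j y t) (x t) \<bullet> h t \<le> - a)
      else
        (LINT t:{0..T}|lebesgue. max_constraint l g (x t) t powr (real_of_ereal p - 1)
           * (SUP v\<in>subdiff l g (x t) t. v \<bullet> h t))
        \<le> - a * penalty_term p T l g x powr (real_of_ereal p - 1))"

end

theory Submission
  imports Defs
begin

text \<open>
  Assumption 3 says that the penalty term \<open>\<phi>\<close> has a descent rate bounded away from zero at every
  infeasible point of the compact set \<open>A\<close>.  Minimising \<open>w \<mapsto> \<phi> w + (b/2) d w y\<close> over \<open>A\<close> then gives
  a feasible point, hence the error bound \<open>d(y, \<Omega>) \<le> 2 \<phi>(y) / b\<close> on all of \<open>A\<close>.  As the cost and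
  \<open>\<phi>\<close> are Lipschitz continuous on \<open>A\<close>, replacing a point by such a nearby feasible point yields
  all parts of complete exactness.

  For \<open>p < \<infinity>\<close> the descent rate comes from two tangent inequalities of \<open>r \<mapsto> r\<^sup>p\<close>,
  \<open>N\<^sup>p\<^sup>-\<^sup>1 (N\<^sub>n - N) \<le> \<integral> c\<^sub>n\<^sup>p\<^sup>-\<^sup>1 (c\<^sub>n - c)\<close> for \<open>c(t) = max {g\<^sub>j(x(t), t), 0}\<close> and
  \<open>N\<close> the norm of \<open>c\<close>, and a reverse Fatou argument; for \<open>p = \<infinity>\<close> it comes from a limit point of maximisers of \<open>c\<^sub>n\<close>.
\<close>

section \<open>Complete exactness from a descent rate\<close>

text \<open>Compactness is used twice. It supplies the minimiser behind the error bound, where a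
  merely complete space would call for Ekeland's principle. It also upgrades convergence in
  \<open>dist_X\<close> to uniform convergence along a subsequence; for
  \<open>p < \<infinity>\<close> the metric alone says nothing about single times, yet the quotients
  of the constraints have to be followed at each time. The obstacle for finite \<open>p\<close> is
  that the constraint maximum has kinks, so its difference quotients are controlled only from above;
  this is why one-sided tangent inequalities and a reverse Fatou argument take the place of
  differentiating the norm. Half of \<open>a\<close> is given up so that the limiting inequality
  already holds at one late index. The assumed bound on the endpoints then converts a rate with
  respect to the norm into a rate with respect to \<open>dist_X\<close>. A single threshold serves
  all four parts: it must beat the Lipschitz constant of the cost with a surplus, because equality
  of the sets of minimisers requires a strict loss at infeasible points.\<close>

lemma inf_stationary_iff:
  assumes pos: "\<And>y. y \<in> K \<Longrightarrow> y \<noteq> z \<Longrightarrow> d y z > 0" and zz: "d z z = 0"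
  shows "inf_stationary d K F z \<longleftrightarrow>
    z \<in> K \<and> (\<forall>e>0. \<exists>r>0. \<forall>y\<in>K. d y z < r \<longrightarrow> F z - e * d y z \<le> F y)"
proof -
  let ?S = "\<lambda>r. {y \<in> K. y \<noteq> z \<and> d y z < r}"
  have ev: "eventually P (INF r\<in>{0<..}. principal (?S r)) \<longleftrightarrow> (\<exists>r>0. \<forall>y\<in>?S r. P y)" for P
  proof (subst eventually_INF_base)
    show "{0<..} \<noteq> ({} :: real set)" by auto
    show "\<exists>x\<in>{0<..}. principal (?S x) \<le> inf (principal (?S a)) (principal (?S b))"
      if "a \<in> {0<..}" "b \<in> {0<..}" for a b
      using that by (intro bexI[of _ "min a b"]) auto
  qed (auto simp: eventually_principal)
  have quot: "ereal (- e) < ereal ((F y - F z) / d y z) \<longleftrightarrow> F z - e * d y z < F y"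
    if "y \<in> K" "y \<noteq> z" for y e
    using pos[OF that] by (simp add: field_simps)
  have "steepest_descent_rate d K F z \<ge> 0 \<longleftrightarrow>
      (\<forall>e>0. \<exists>r>0. \<forall>y\<in>?S r. F z - e * d y z < F y)"
  proof
    assume L: "steepest_descent_rate d K F z \<ge> 0"
    show "\<forall>e>0. \<exists>r>0. \<forall>y\<in>?S r. F z - e * d y z < F y"
    proof (intro allI impI)
      fix e :: real assume "e > 0"
      then have "ereal (- e) < steepest_descent_rate d K F z"
        using L by (intro less_le_trans[OF _ L]) simp
      then have "\<exists>r>0. \<forall>y\<in>?S r. ereal (- e) < ereal ((F y - F z) / d y z)"
        unfolding steepest_descent_rate_def by (intro iffD1[OF ev] less_LiminfD)
      then show "\<exists>r>0. \<forall>y\<in>?S r. F z - e * d y z < F y"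
        using quot by blast
    qed
  next
    assume R: "\<forall>e>0. \<exists>r>0. \<forall>y\<in>?S r. F z - e * d y z < F y"
    show "steepest_descent_rate d K F z \<ge> 0"
      unfolding steepest_descent_rate_def
    proof (subst le_Liminf_iff, intro allI impI)
      fix b :: ereal assume "b < 0"
      then obtain e where e: "b \<le> ereal (- e)" "e > 0"
      proof (cases b)
        case (real r) with \<open>b < 0\<close> show ?thesis by (intro that[of "- r"]) auto
      qed (auto intro: that[of 1])
      obtain r where "r > 0" and r: "\<And>y. y \<in> ?S r \<Longrightarrow> F z - e * d y z < F y"
        using R e(2) by blast
      have "b < ereal ((F y - F z) / d y z)" if "y \<in> ?S r" for y
        using that r[OF that] quot[of y e] e(1) by (auto intro: le_less_trans)
      then show "eventually (\<lambda>y. b < ereal ((F y - F z) / d y z))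
          (INF r\<in>{0<..}. principal (?S r))"
        unfolding ev using \<open>r > 0\<close> by blast
    qed
  qed
  \<comment> \<open>Weak inequalities that also admit \<open>y = z\<close> need no division and
    treat isolated points uniformly. In this form a condition on \<open>\<Omega>\<close> can later
    be carried over to \<open>A\<close> by replacing \<open>y\<close> with a nearby feasible
    point.\<close>
  also have "\<dots> \<longleftrightarrow> (\<forall>e>0. \<exists>r>0. \<forall>y\<in>K. d y z < r \<longrightarrow> F z - e * d y z \<le> F y)" (is "?P \<longleftrightarrow> ?Q")
  proof
    assume ?P
    show ?Q
    proof (intro allI impI)
      fix e :: real assume "e > 0"
      then obtain r where "r > 0" and r: "\<And>y. y \<in> ?S r \<Longrightarrow> F z - e * d y z < F y"
        using \<open>?P\<close> by blast
      have "F z - e * d y z \<le> F y" if "y \<in> K" "d y z < r" for y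
        using r[of y] that zz by (cases "y = z") auto
      then show "\<exists>r>0. \<forall>y\<in>K. d y z < r \<longrightarrow> F z - e * d y z \<le> F y" using \<open>r > 0\<close> by blast
    qed
  next
    assume ?Q
    show ?P
    proof (intro allI impI)
      fix e :: real assume "e > 0"
      \<comment> \<open>Applying the weak form with \<open>e / 2\<close> leaves the positive slack
        \<open>e / 2 * d y z\<close>, which restores strictness.\<close>
      then obtain r where "r > 0" and r: "\<And>y. y \<in> K \<Longrightarrow> d y z < r \<Longrightarrow> F z - e / 2 * d y z \<le> F y"
        using \<open>?Q\<close> half_gt_zero[of e] by blast
      have "F z - e * d y z < F y" if "y \<in> ?S r" for y
      proof -
        have "e / 2 * d y z > 0" using \<open>e > 0\<close> pos[of y] that by simp
        then show ?thesis using r[of y] that by simp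
      qed
      then show "\<exists>r>0. \<forall>y\<in>?S r. F z - e * d y z < F y" using \<open>r > 0\<close> by blast
    qed
  qed
  finally show ?thesis by (auto simp: inf_stationary_def)
qed

text \<open>The weight \<open>b / 2\<close> is strictly below the slope \<open>b\<close>: a slope
  step away from the minimiser lowers \<open>\<phi>\<close> by \<open>b * d x w\<close>, while by
  the triangle inequality the distance term grows by at most half of that. Comparing the minimum
  with the value at \<open>y\<close> itself gives the bound.\<close>

lemma error_bound_of_slope:
  fixes \<phi> :: "'x \<Rightarrow> real"
  assumes sym: "\<And>x y. x \<in> A \<Longrightarrow> y \<in> A \<Longrightarrow> d x y = d y x"
    and tri: "\<And>x y z. x \<in> A \<Longrightarrow> y \<in> A \<Longrightarrow> z \<in> A \<Longrightarrow> d x z \<le> d x y + d y z"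
    and pos: "\<And>x y. x \<in> A \<Longrightarrow> y \<in> A \<Longrightarrow> x \<noteq> y \<Longrightarrow> d x y > 0"
    and zero: "\<And>x. x \<in> A \<Longrightarrow> d x x = 0"
    and comp: "\<And>s :: nat \<Rightarrow> 'x. (\<And>n. s n \<in> A) \<Longrightarrow>
      \<exists>x\<in>A. \<exists>r. strict_mono r \<and> (\<lambda>n. d (s (r n)) x) \<longlonglongrightarrow> 0"
    and nonneg: "\<And>x. x \<in> A \<Longrightarrow> \<phi> x \<ge> 0"
    and lip: "\<And>x y. x \<in> A \<Longrightarrow> y \<in> A \<Longrightarrow> \<phi> x - \<phi> y \<le> K * d x y"
    and b: "b > 0"
    and slope: "\<And>x. x \<in> A \<Longrightarrow> \<phi> x \<noteq> 0 \<Longrightarrow>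
      \<exists>x'\<in>A. x' \<noteq> x \<and> \<phi> x' \<le> \<phi> x - b * d x' x"
    and y: "y \<in> A"
  shows "\<exists>w\<in>A. \<phi> w = 0 \<and> b / 2 * d w y \<le> \<phi> y"
proof -
  let ?F = "\<lambda>w. \<phi> w + b / 2 * d w y"
  define m where "m = Inf (?F ` A)"
  have dnn: "d x y \<ge> 0" if "x \<in> A" "y \<in> A" for x y
    using pos[OF that] zero[OF that(1)] by (cases "x = y") auto
  have bdd: "bdd_below (?F ` A)"
    using nonneg dnn[OF _ y] b by (intro bdd_belowI[of _ 0]) auto
  have "\<exists>w\<in>A. ?F w < m + 1 / Suc n" for n
    using cInf_lessD[of "?F ` A" "m + 1 / Suc n"] y by (auto simp: m_def)
  then obtain s where s: "\<And>n. s n \<in> A" "\<And>n. ?F (s n) < m + 1 / Suc n" by metis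
  obtain w r where w: "w \<in> A" and r: "strict_mono r" and lim: "(\<lambda>n. d (s (r n)) w) \<longlonglongrightarrow> 0"
    using comp[of s] s(1) by blast
  \<comment> \<open>The Lipschitz bound makes the perturbed function at the limit exceed its value
    along the subsequence by at most \<open>(K + b / 2)\<close> times the distance. Since
    \<open>r n \<ge> n\<close>, the error \<open>1 / Suc (r n)\<close> is at most
    \<open>1 / Suc n\<close>.\<close>
  have "?F w \<le> m + (1 / Suc n + (K + b / 2) * d (s (r n)) w)" for n
  proof -
    have "\<phi> w - \<phi> (s (r n)) \<le> K * d (s (r n)) w"
      using lip[OF w s(1)] sym[OF w s(1)] by simp
    moreover have "d w y \<le> d (s (r n)) w + d (s (r n)) y"
      using tri[OF w s(1) y] sym[OF w s(1)] by simp
    then have "b / 2 * d w y \<le> b / 2 * (d (s (r n)) w + d (s (r n)) y)"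
      using b by (intro mult_left_mono) auto
    moreover have "1 / Suc (r n) \<le> 1 / Suc n"
      using seq_suble[OF r, of n] by (simp add: frac_le)
    ultimately show ?thesis using s(2)[of "r n"] by (simp add: algebra_simps)
  qed
  moreover have "(\<lambda>n. m + (1 / Suc n + (K + b / 2) * d (s (r n)) w)) \<longlonglongrightarrow> m + (0 + (K + b / 2) * 0)"
    by (intro tendsto_intros lim) (use LIMSEQ_Suc[OF lim_1_over_n] in simp)
  ultimately have "?F w \<le> m" using LIMSEQ_le_const by fastforce
  then have min: "?F w \<le> ?F x" if "x \<in> A" for x
    using cInf_lower[OF _ bdd] that unfolding m_def by fastforce
  have "\<phi> w = 0"
  proof (rule ccontr)
    assume "\<phi> w \<noteq> 0"
    then obtain x where x: "x \<in> A" "x \<noteq> w" "\<phi> x \<le> \<phi> w - b * d x w" using slope[OF w] by blast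
    have "b / 2 * d x y \<le> b / 2 * (d x w + d w y)" using tri[OF x(1) w y] b by simp
    then have "?F x \<le> ?F w - b / 2 * d x w" using x(3) by (simp add: algebra_simps)
    moreover have "b / 2 * d x w > 0" using pos[OF x(1) w x(2)] b by simp
    ultimately show False using min[OF x(1)] by simp
  qed
  moreover have "b / 2 * d w y \<le> \<phi> y" using min[OF y] zero[OF y] \<open>\<phi> w = 0\<close> by simp
  ultimately show ?thesis using w by blast
qed

text \<open>The radius \<open>r\<close> in the slope condition is arbitrary because local optimality
  and stationarity are tested near a point; the error bound itself uses the condition only with
  radius 1.\<close>

lemma completely_exact_of_slope:
  fixes I \<phi> :: "'x \<Rightarrow> real"
  assumes sym: "\<And>x y. x \<in> A \<Longrightarrow> y \<in> A \<Longrightarrow> d x y = d y x"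
    and tri: "\<And>x y z. x \<in> A \<Longrightarrow> y \<in> A \<Longrightarrow> z \<in> A \<Longrightarrow> d x z \<le> d x y + d y z"
    and pos: "\<And>x y. x \<in> A \<Longrightarrow> y \<in> A \<Longrightarrow> x \<noteq> y \<Longrightarrow> d x y > 0"
    and zero: "\<And>x. x \<in> A \<Longrightarrow> d x x = 0"
    and comp: "\<And>s :: nat \<Rightarrow> 'x. (\<And>n. s n \<in> A) \<Longrightarrow>
      \<exists>x\<in>A. \<exists>r. strict_mono r \<and> (\<lambda>n. d (s (r n)) x) \<longlonglongrightarrow> 0"
    and nonneg: "\<And>x. x \<in> A \<Longrightarrow> \<phi> x \<ge> 0"
    and lip: "\<And>x y. x \<in> A \<Longrightarrow> y \<in> A \<Longrightarrow> \<phi> x - \<phi> y \<le> K * d x y"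
    and lipI: "\<And>x y. x \<in> A \<Longrightarrow> y \<in> A \<Longrightarrow> I x - I y \<le> L * d x y"
    and b: "b > 0"
    and slope: "\<And>x r. x \<in> A \<Longrightarrow> \<phi> x \<noteq> 0 \<Longrightarrow> r > 0 \<Longrightarrow>
      \<exists>x'\<in>A. x' \<noteq> x \<and> d x' x < r \<and> \<phi> x' \<le> \<phi> x - b * d x' x"
  shows "completely_exact d A {x \<in> A. \<phi> x = 0} I (\<lambda>c x. I x + c * \<phi> x)"
proof -
  define \<Omega> where "\<Omega> = {x \<in> A. \<phi> x = 0}"
  \<comment> \<open>Moving to a feasible point at distance \<open>d\<close> raises the cost by at
    most \<open>\<bar>L\<bar> * d\<close>, and the error bound guarantees a penalty of at least
    \<open>b / 2 * d\<close>. The extra 1 leaves a gain of \<open>d\<close>.\<close>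
  define c0 where "c0 = 2 * (\<bar>L\<bar> + 1) / b"
  have sub: "\<Omega> \<subseteq> A" by (auto simp: \<Omega>_def)
  have dnn: "d x y \<ge> 0" if "x \<in> A" "y \<in> A" for x y
    using pos[OF that] zero[OF that(1)] by (cases "x = y") auto
  have proj: "\<exists>w\<in>\<Omega>. b / 2 * d w y \<le> \<phi> y" if "y \<in> A" for y
  proof -
    have "\<exists>w\<in>A. \<phi> w = 0 \<and> b / 2 * d w y \<le> \<phi> y"
    proof (rule error_bound_of_slope[where d = d])
      show "\<exists>x'\<in>A. x' \<noteq> x \<and> \<phi> x' \<le> \<phi> x - b * d x' x" if "x \<in> A" "\<phi> x \<noteq> 0" for x
        using slope[OF that zero_less_one] by blast
    qed (fact sym tri pos zero comp nonneg lip b that)+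
    then show ?thesis by (auto simp: \<Omega>_def)
  qed
  have lipI': "I x - I y \<le> \<bar>L\<bar> * d x y" if "x \<in> A" "y \<in> A" for x y
  proof -
    have "L * d x y \<le> \<bar>L\<bar> * d x y" using dnn[OF that] by (intro mult_right_mono) auto
    then show ?thesis using lipI[OF that] by simp
  qed
  have Phi_Om: "\<phi> x = 0" if "x \<in> \<Omega>" for x
    using that by (simp add: \<Omega>_def)
  have c0: "c0 \<ge> 0" using b by (simp add: c0_def)
  have key: "(INF x\<in>\<Omega>. ereal (I x)) = (INF x\<in>A. ereal (I x + c * \<phi> x))
      \<and> {z. globally_optimal \<Omega> I z} = {z. globally_optimal A (\<lambda>x. I x + c * \<phi> x) z}
      \<and> (\<forall>z\<in>A. locally_optimal d A (\<lambda>x. I x + c * \<phi> x) z \<longleftrightarrow> z \<in> \<Omega> \<and> locally_optimal d \<Omega> I z)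
      \<and> (\<forall>z\<in>A. inf_stationary d A (\<lambda>x. I x + c * \<phi> x) z \<longleftrightarrow> z \<in> \<Omega> \<and> inf_stationary d \<Omega> I z)"
    if c: "c \<ge> c0" for c
  proof -
    let ?P = "\<lambda>x. I x + c * \<phi> x"
    have cb: "c * b \<ge> 2 * (\<bar>L\<bar> + 1)" using c b by (simp add: c0_def field_simps)
    have cnn: "c \<ge> 0" using c c0 by simp
    have best: "\<exists>w\<in>\<Omega>. I w + d w y \<le> ?P y \<and> b / 2 * d w y \<le> \<phi> y" if y: "y \<in> A" for y
    proof -
      obtain w where w: "w \<in> \<Omega>" "b / 2 * d w y \<le> \<phi> y" using proj[OF y] by blast
      have d0: "d w y \<ge> 0" using dnn y w sub by blast
      have "(\<bar>L\<bar> + 1) * d w y \<le> c * b / 2 * d w y" using cb d0 by (intro mult_right_mono) auto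
      also have "\<dots> \<le> c * \<phi> y" using mult_left_mono[OF w(2) cnn] by simp
      finally have "I w + d w y \<le> ?P y" using lipI'[of w y] w(1) sub y by (auto simp: algebra_simps)
      then show ?thesis using w by blast
    qed
    \<comment> \<open>The same threshold gives \<open>c * b - \<bar>L\<bar> \<ge> 2\<close>, so the
      penalised cost descends with rate 2 at every infeasible point. This excludes local minimisers
      there, and also stationary points, by testing with \<open>e = 1\<close>.\<close>
    have descent: "\<exists>x'\<in>A. x' \<noteq> x \<and> d x' x < r \<and> ?P x' \<le> ?P x - 2 * d x' x"
      if x: "x \<in> A" "x \<notin> \<Omega>" "r > 0" for x r
    proof -
      obtain x' where x': "x' \<in> A" "x' \<noteq> x" "d x' x < r" "\<phi> x' \<le> \<phi> x - b * d x' x"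
        using slope[of x r] x by (auto simp: \<Omega>_def)
      have "c * \<phi> x' \<le> c * (\<phi> x - b * d x' x)" using x'(4) cnn by (rule mult_left_mono)
      moreover have "2 * (\<bar>L\<bar> + 1) * d x' x \<le> c * b * d x' x"
        using cb dnn[OF x'(1) x(1)] by (rule mult_right_mono)
      moreover have "\<bar>L\<bar> * d x' x \<ge> 0" using dnn[OF x'(1) x(1)] by simp
      ultimately have "?P x' \<le> ?P x - 2 * d x' x"
        using lipI'[OF x'(1) x(1)] by (simp add: algebra_simps)
      then show ?thesis using x' by blast
    qed
    \<comment> \<open>Near a feasible \<open>z\<close> the penalty at \<open>y\<close> is at most
      \<open>\<bar>K\<bar> * d y z\<close>, so the error bound puts the feasible substitute
      \<open>w\<close> within \<open>2 * \<bar>K\<bar> / b * d y z\<close> of \<open>y\<close>;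
      adding \<open>d y z\<close> gives \<open>k\<close>. Radii are therefore divided by
      \<open>k\<close> when passing from \<open>\<Omega>\<close> to \<open>A\<close>.\<close>
    define k where "k = 1 + 2 * \<bar>K\<bar> / b"
    have k: "k > 0" using b by (simp add: k_def add_pos_nonneg)
    have near: "d w z \<le> k * d y z" if "z \<in> \<Omega>" "y \<in> A" "w \<in> \<Omega>" "b / 2 * d w y \<le> \<phi> y" for z y w
    proof -
      have zA: "z \<in> A" and wA: "w \<in> A" and z0: "\<phi> z = 0" using that by (auto simp: \<Omega>_def)
      have "K * d y z \<le> \<bar>K\<bar> * d y z" using dnn[OF that(2) zA] by (intro mult_right_mono) auto
      then have "\<phi> y \<le> \<bar>K\<bar> * d y z" using lip[OF that(2) zA] z0 by simp
      then have "d w y \<le> 2 * \<bar>K\<bar> / b * d y z" using that(4) b by (simp add: field_simps)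
      then show ?thesis using tri[OF wA that(2) zA] by (simp add: k_def algebra_simps)
    qed
    have "(INF x\<in>\<Omega>. ereal (I x)) = (INF x\<in>A. ereal (?P x))"
    proof (rule antisym)
      show "(INF x\<in>\<Omega>. ereal (I x)) \<le> (INF x\<in>A. ereal (?P x))"
      proof (rule INF_mono)
        fix y assume y: "y \<in> A"
        obtain w where "w \<in> \<Omega>" "I w + d w y \<le> ?P y" using best[OF y] by blast
        moreover have "d w y \<ge> 0" using dnn y \<open>w \<in> \<Omega>\<close> sub by blast
        ultimately show "\<exists>w\<in>\<Omega>. ereal (I w) \<le> ereal (?P y)" by (intro bexI[of _ w]) auto
      qed
      show "(INF x\<in>A. ereal (?P x)) \<le> (INF x\<in>\<Omega>. ereal (I x))"
      proof (rule INF_mono)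
        show "\<exists>x\<in>A. ereal (?P x) \<le> ereal (I y)" if "y \<in> \<Omega>" for y
          using that sub Phi_Om by (intro bexI[of _ y]) auto
      qed
    qed
    moreover have "globally_optimal \<Omega> I z \<longleftrightarrow> globally_optimal A ?P z" for z
    proof
      assume z: "globally_optimal \<Omega> I z"
      then have zO: "z \<in> \<Omega>" and min: "\<And>y. y \<in> \<Omega> \<Longrightarrow> I z \<le> I y" by (auto simp: globally_optimal_def)
      have "?P z \<le> ?P y" if y: "y \<in> A" for y
      proof -
        obtain w where w: "w \<in> \<Omega>" "I w + d w y \<le> ?P y" using best[OF y] by blast
        have "d w y \<ge> 0" using dnn y \<open>w \<in> \<Omega>\<close> sub by blast
        then show ?thesis using min[OF w(1)] w(2) Phi_Om[OF zO] by simp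
      qed
      then show "globally_optimal A ?P z" using zO sub by (auto simp: globally_optimal_def)
    next
      assume z: "globally_optimal A ?P z"
      then have zA: "z \<in> A" and min: "\<And>y. y \<in> A \<Longrightarrow> ?P z \<le> ?P y" by (auto simp: globally_optimal_def)
      obtain w where w: "w \<in> \<Omega>" "I w + d w z \<le> ?P z" using best[OF zA] by blast
      have "?P z \<le> I w" using min[of w] w(1) sub Phi_Om by auto
      \<comment> \<open>The two inequalities leave \<open>d w z \<le> 0\<close>; the surplus 1 in
        the threshold is what forces the minimiser to be feasible.\<close>
      then have "w = z" using pos[of w z] w sub zA by force
      then have "z \<in> \<Omega>" using w(1) by simp
      then have "I z \<le> I y" if "y \<in> \<Omega>" for y using min[of y] that sub Phi_Om by auto
      then show "globally_optimal \<Omega> I z" using \<open>z \<in> \<Omega>\<close> by (auto simp: globally_optimal_def)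
    qed
    moreover have "locally_optimal d A ?P z \<longleftrightarrow> z \<in> \<Omega> \<and> locally_optimal d \<Omega> I z" if zA: "z \<in> A" for z
    proof
      assume "locally_optimal d A ?P z"
      then obtain r where r: "r > 0" "\<And>y. y \<in> A \<Longrightarrow> d y z < r \<Longrightarrow> ?P z \<le> ?P y"
        by (auto simp: locally_optimal_def)
      have "z \<in> \<Omega>"
      proof (rule ccontr)
        assume "z \<notin> \<Omega>"
        then obtain x where x: "x \<in> A" "x \<noteq> z" "d x z < r" "?P x \<le> ?P z - 2 * d x z"
          using descent[OF zA _ r(1)] by blast
        then show False using r(2)[of x] pos[OF x(1) zA x(2)] by simp
      qed
      moreover have "I z \<le> I y" if "y \<in> \<Omega>" "d y z < r" for y
        using r(2)[of y] that sub Phi_Om[OF that(1)] Phi_Om[OF \<open>z \<in> \<Omega>\<close>] by auto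
      ultimately show "z \<in> \<Omega> \<and> locally_optimal d \<Omega> I z"
        using r(1) by (auto simp: locally_optimal_def)
    next
      assume z: "z \<in> \<Omega> \<and> locally_optimal d \<Omega> I z"
      then obtain r where r: "r > 0" "\<And>y. y \<in> \<Omega> \<Longrightarrow> d y z < r \<Longrightarrow> I z \<le> I y"
        by (auto simp: locally_optimal_def)
      have "?P z \<le> ?P y" if y: "y \<in> A" "d y z < r / k" for y
      proof -
        obtain w where w: "w \<in> \<Omega>" "I w + d w y \<le> ?P y" "b / 2 * d w y \<le> \<phi> y"
          using best[OF y(1)] by blast
        have "d w z < r" using near[of z y w] z y w k by (simp add: field_simps)
        moreover have "d w y \<ge> 0" using dnn y(1) w(1) sub by blast
        ultimately show ?thesis using r(2)[OF w(1)] w(2) Phi_Om[of z] z by simp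
      qed
      then show "locally_optimal d A ?P z"
        using zA r(1) k unfolding locally_optimal_def by (intro conjI exI[of _ "r / k"]) auto
    qed
    moreover have "inf_stationary d A ?P z \<longleftrightarrow> z \<in> \<Omega> \<and> inf_stationary d \<Omega> I z" if zA: "z \<in> A" for z
    proof -
      have iA: "inf_stationary d A ?P z \<longleftrightarrow>
          z \<in> A \<and> (\<forall>e>0. \<exists>r>0. \<forall>y\<in>A. d y z < r \<longrightarrow> ?P z - e * d y z \<le> ?P y)"
        by (rule inf_stationary_iff) (use pos zero zA in auto)
      have iO: "inf_stationary d \<Omega> I z \<longleftrightarrow>
          z \<in> \<Omega> \<and> (\<forall>e>0. \<exists>r>0. \<forall>y\<in>\<Omega>. d y z < r \<longrightarrow> I z - e * d y z \<le> I y)"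
        by (rule inf_stationary_iff) (use pos zero zA sub in auto)
      show ?thesis
      proof
        assume "inf_stationary d A ?P z"
        then have st: "\<exists>r>0. \<forall>y\<in>A. d y z < r \<longrightarrow> ?P z - e * d y z \<le> ?P y" if "e > 0" for e
          using iA that by blast
        have "z \<in> \<Omega>"
        proof (rule ccontr)
          assume "z \<notin> \<Omega>"
          obtain r where r: "r > 0" "\<forall>y\<in>A. d y z < r \<longrightarrow> ?P z - 1 * d y z \<le> ?P y"
            using st[OF zero_less_one] by blast
          obtain x where x: "x \<in> A" "x \<noteq> z" "d x z < r" "?P x \<le> ?P z - 2 * d x z"
            using descent[OF zA \<open>z \<notin> \<Omega>\<close> r(1)] by blast
          then show False using r(2) pos[OF x(1) zA x(2)] by fastforce
        qed
        moreover have "\<exists>r>0. \<forall>y\<in>\<Omega>. d y z < r \<longrightarrow> I z - e * d y z \<le> I y" if "e > 0" for e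
        proof -
          obtain r where r: "r > 0" "\<And>y. y \<in> A \<Longrightarrow> d y z < r \<Longrightarrow> ?P z - e * d y z \<le> ?P y"
            using st[OF \<open>e > 0\<close>] by blast
          have "I z - e * d y z \<le> I y" if "y \<in> \<Omega>" "d y z < r" for y
            using r(2)[of y] that sub Phi_Om[OF that(1)] Phi_Om[OF \<open>z \<in> \<Omega>\<close>] by auto
          then show ?thesis using r(1) by blast
        qed
        ultimately show "z \<in> \<Omega> \<and> inf_stationary d \<Omega> I z" using iO by blast
      next
        assume z: "z \<in> \<Omega> \<and> inf_stationary d \<Omega> I z"
        have "\<exists>r>0. \<forall>y\<in>A. d y z < r \<longrightarrow> ?P z - e * d y z \<le> ?P y" if e: "e > 0" for e
        proof -
          \<comment> \<open>The tolerance shrinks by \<open>k\<close> along with the radius, because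
            the error term on \<open>\<Omega>\<close> involves \<open>d w z\<close>, which may be
            \<open>k\<close> times as large as \<open>d y z\<close>.\<close>
          have "e / k > 0" using e k by simp
          then obtain r where r: "r > 0" "\<And>y. y \<in> \<Omega> \<Longrightarrow> d y z < r \<Longrightarrow> I z - e / k * d y z \<le> I y"
            using z iO by meson
          have "?P z - e * d y z \<le> ?P y" if y: "y \<in> A" "d y z < r / k" for y
          proof -
            obtain w where w: "w \<in> \<Omega>" "I w + d w y \<le> ?P y" "b / 2 * d w y \<le> \<phi> y"
              using best[OF y(1)] by blast
            have nr: "d w z \<le> k * d y z" using near[of z y w] z y w by simp
            then have "d w z < r" using y k by (simp add: field_simps)
            have "e / k * d w z \<le> e / k * (k * d y z)" using nr e k by (intro mult_left_mono) auto
            then have "e / k * d w z \<le> e * d y z" using k by simp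
            moreover have "d w y \<ge> 0" using dnn y(1) w(1) sub by blast
            ultimately show ?thesis using r(2)[OF w(1) \<open>d w z < r\<close>] w(2) Phi_Om[of z] z by simp
          qed
          moreover have "r / k > 0" using r(1) k by simp
          ultimately show ?thesis by blast
        qed
        then show "inf_stationary d A ?P z" using iA zA by blast
      qed
    qed
    ultimately show ?thesis by (intro conjI) (auto simp del: add_0_right)
  qed
  show ?thesis
    unfolding completely_exact_def \<Omega>_def[symmetric] using c0 key by blast
qed

section \<open>The norms of continuous functions\<close>

text \<open>The graph of the convex power lies above its tangent at \<open>b\<close>. Convexity and
  the derivative are used on the open half-line, so the cases in which \<open>a\<close> or
  \<open>b\<close> is 0 are checked directly.\<close>

lemma powr_tangent_le:
  fixes a b s :: real
  assumes "a \<ge> 0" "b \<ge> 0" "s > 1"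
  shows "b powr s - a powr s \<le> s * b powr (s - 1) * (b - a)"
proof -
  consider "b = 0" | "b > 0" "a = 0" | "b > 0" "a > 0" using assms by fastforce
  then show ?thesis
  proof cases
    case 2
    have "b powr s = b powr (s - 1) * b" using 2 by (simp add: powr_mult_base mult.commute)
    then have "s * b powr (s - 1) * (b - a) = s * b powr s" using 2 by simp
    moreover have "1 * b powr s \<le> s * b powr s" using assms(3) by (intro mult_right_mono) auto
    moreover have "a powr s = 0" using 2 by simp
    ultimately show ?thesis by linarith
  next
    case 3
    have "a powr s - b powr s \<ge> s * b powr (s - 1) * (a - b)"
    proof (rule convex_on_imp_above_tangent)
      show "convex_on {0<..} (\<lambda>x. x powr s)" using assms by (intro powr_convex) simp
      show "((\<lambda>x. x powr s) has_real_derivative s * b powr (s - 1)) (at b within {0<..})"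
        using 3 by (auto intro!: derivative_eq_intros)
    qed (use 3 in \<open>auto simp: interior_open\<close>)
    then show ?thesis by (simp add: algebra_simps)
  qed auto
qed

text \<open>The tangent inequalities at the mean \<open>c\<close> are averaged with weights
  \<open>u\<close> and \<open>v\<close>, and the linear terms cancel. This covers the closed
  half-line, including 0.\<close>

lemma powr_convex_nonneg:
  fixes a b s u v :: real
  assumes "a \<ge> 0" "b \<ge> 0" "s > 1" "u \<ge> 0" "v \<ge> 0" "u + v = 1"
  shows "(u * a + v * b) powr s \<le> u * a powr s + v * b powr s"
proof -
  define c where "c = u * a + v * b"
  have c: "c \<ge> 0" using assms by (simp add: c_def)
  have "u * (c powr s - a powr s) + v * (c powr s - b powr s)
      \<le> u * (s * c powr (s - 1) * (c - a)) + v * (s * c powr (s - 1) * (c - b))"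
    using assms c by (intro add_mono mult_left_mono powr_tangent_le) auto
  also have "\<dots> = s * c powr (s - 1) * ((u + v) * c - (u * a + v * b))" by (simp add: algebra_simps)
  also have "\<dots> = 0" using assms(6) by (simp add: c_def)
  finally have "(u + v) * c powr s \<le> u * a powr s + v * b powr s" by (simp add: algebra_simps)
  then show ?thesis using assms(6) by (simp add: c_def)
qed

text \<open>Convexity at the midpoint. The constant is generous, since only integrability of a power
  of a sum is at stake.\<close>

lemma powr_add_le:
  fixes a b s :: real
  assumes "a \<ge> 0" "b \<ge> 0" "s > 1"
  shows "(a + b) powr s \<le> 2 powr s * (a powr s + b powr s)"
proof -
  have "(a + b) powr s = 2 powr s * (1/2 * a + 1/2 * b) powr s"
    using assms by (subst powr_mult[symmetric]) auto
  also have "\<dots> \<le> 2 powr s * (1/2 * a powr s + 1/2 * b powr s)"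
    using assms by (intro mult_left_mono powr_convex_nonneg) auto
  also have "\<dots> \<le> 2 powr s * (a powr s + b powr s)"
    using powr_ge_zero[of a s] powr_ge_zero[of b s] by (intro mult_left_mono[OF _ powr_ge_zero]) linarith
  finally show ?thesis .
qed

text \<open>By continuity a violation at one time persists on a nonempty open interval, which is not
  negligible. This turns almost-everywhere information about representatives into statements at
  every time.\<close>

lemma AE_le_imp_le_of_continuous:
  fixes u :: "real \<Rightarrow> real"
  assumes "T > 0" and u: "continuous_on {0..T} u"
    and ae: "AE t in lebesgue_on {0..T}. u t \<le> C" and t: "t \<in> {0..T}"
  shows "u t \<le> C"
proof (rule ccontr)
  assume "\<not> u t \<le> C"
  then have "u t - C > 0" by simp
  then obtain \<delta> where \<delta>: "\<delta> > 0" "\<And>s. s \<in> {0..T} \<Longrightarrow> dist s t < \<delta> \<Longrightarrow> dist (u s) (u t) < u t - C"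
    using u t unfolding continuous_on_iff by meson
  \<comment> \<open>Clipping to the interior of \<open>{0..T}\<close> keeps the interval nonempty
    even when \<open>t\<close> is an endpoint.\<close>
  define V where "V = {max 0 (t - \<delta>)<..<min T (t + \<delta>)}"
  have "AE s in lebesgue. s \<in> {0..T} \<longrightarrow> u s \<le> C"
    using ae by (subst (asm) AE_restrict_space_iff) auto
  then obtain N where N: "N \<in> null_sets lebesgue" "{s. \<not> (s \<in> {0..T} \<longrightarrow> u s \<le> C)} \<subseteq> N"
    by (auto simp: eventually_ae_filter)
  have "V \<subseteq> N"
  proof
    fix s assume "s \<in> V"
    then have s: "s \<in> {0..T}" "dist s t < \<delta>" using t by (auto simp: V_def dist_real_def)
    then have "u s > C" using \<delta>(2)[OF s] by (auto simp: dist_real_def)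
    then show "s \<in> N" using N(2) s by auto
  qed
  then have "negligible V"
    using N(1) by (meson negligible_iff_null_sets negligible_subset)
  moreover have "V \<noteq> {}" "open V" using t \<delta>(1) \<open>T > 0\<close> by (auto simp: V_def)
  ultimately show False using open_not_negligible by blast
qed

lemma continuous_measurable_on_interval:
  fixes y :: "real \<Rightarrow> 'b::euclidean_space"
  assumes "continuous_on {0..T} y"
  shows "y \<in> borel_measurable (lebesgue_on {0..T})"
  using assms by (intro continuous_imp_measurable_on_sets_lebesgue) auto

text \<open>A real number strictly between the essential supremum and the maximum would bound the
  function almost everywhere, hence everywhere. The attained maximum provides the times on which the
  case \<open>p = \<infinity>\<close> is built.\<close>

lemma Lp_norm_infinity_continuous:
  fixes y :: "real \<Rightarrow> 'b::euclidean_space"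
  assumes "T > 0" and y: "continuous_on {0..T} y"
  shows "\<exists>t\<in>{0..T}. Lp_norm \<infinity> T y = norm (y t) \<and> (\<forall>s\<in>{0..T}. norm (y s) \<le> norm (y t))"
proof -
  have cn: "continuous_on {0..T} (\<lambda>t. norm (y t))" by (intro continuous_intros y)
  obtain t where t: "t \<in> {0..T}" "\<And>s. s \<in> {0..T} \<Longrightarrow> norm (y s) \<le> norm (y t)"
    using continuous_attains_sup[OF _ _ cn] \<open>T > 0\<close> by force
  let ?e = "esssup (lebesgue_on {0..T}) (\<lambda>t. ereal (norm (y t)))"
  have [measurable]: "y \<in> borel_measurable (lebesgue_on {0..T})"
    by (rule continuous_measurable_on_interval[OF y])
  have "?e \<le> ereal (norm (y t))"
    by (rule esssup_I) (auto intro!: AE_I2 t(2))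
  moreover have "\<not> ?e < ereal (norm (y t))"
  proof
    assume "?e < ereal (norm (y t))"
    then obtain r where r: "?e < ereal r" "ereal r < ereal (norm (y t))"
      using ereal_dense2 by blast
    have le_r: "norm (y s) \<le> r" if "ereal (norm (y s)) \<le> ?e" for s
      using le_less_trans[OF that r(1)] by simp
    have "AE s in lebesgue_on {0..T}. norm (y s) \<le> r"
      using esssup_AE[of "\<lambda>t. ereal (norm (y t))" "lebesgue_on {0..T}"]
      by eventually_elim (rule le_r)
    then have "norm (y t) \<le> r" by (rule AE_le_imp_le_of_continuous[OF \<open>T > 0\<close> cn _ t(1)])
    then show False using r(2) by simp
  qed
  ultimately have "?e = ereal (norm (y t))" by simp
  then have "Lp_norm \<infinity> T y = norm (y t)" by (simp add: Lp_norm_def)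
  then show ?thesis using t by blast
qed

lemma norm_le_Lp_norm_infinity:
  fixes y :: "real \<Rightarrow> 'b::euclidean_space"
  assumes "T > 0" "continuous_on {0..T} y" "s \<in> {0..T}"
  shows "norm (y s) \<le> Lp_norm \<infinity> T y"
  using Lp_norm_infinity_continuous[OF assms(1,2)] assms(3) by auto

lemma finite_exponent:
  assumes "1 < p" "p \<noteq> (\<infinity>::ereal)"
  shows "real_of_ereal p > 1" "p = ereal (real_of_ereal p)"
  using assms by (cases p; auto)+

lemma Lp_norm_finite_powr:
  fixes y :: "real \<Rightarrow> 'b::euclidean_space"
  assumes "1 < p" "p \<noteq> \<infinity>"
  shows "Lp_norm p T y powr real_of_ereal p
      = (LINT t|lebesgue_on {0..T}. norm (y t) powr real_of_ereal p)"
  using finite_exponent[OF assms] assms by (simp add: Lp_norm_def powr_powr integral_nonneg_AE)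

lemma Lp_norm_finite_nonneg: "p \<noteq> \<infinity> \<Longrightarrow> Lp_norm p T y \<ge> 0"
  by (simp add: Lp_norm_def)

lemma Lp_norm_nonneg:
  assumes "T > 0" "continuous_on {0..T} y"
  shows "Lp_norm p T y \<ge> 0"
  using Lp_norm_infinity_continuous[OF assms] by (cases "p = \<infinity>") (auto simp: Lp_norm_finite_nonneg)

lemma integrable_norm_powr:
  fixes y :: "real \<Rightarrow> 'b::euclidean_space"
  assumes "continuous_on {0..T} y" "s > 0"
  shows "integrable (lebesgue_on {0..T}) (\<lambda>t. norm (y t) powr s)"
  by (intro continuous_imp_integrable_real continuous_on_powr' continuous_intros assms)
     (use assms(2) in auto)

lemma continuous_in_Lp_space:
  fixes y :: "real \<Rightarrow> 'b::euclidean_space"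
  assumes "continuous_on {0..T} y" "1 < p" "p \<noteq> \<infinity>"
  shows "y \<in> Lp_space p T"
  using integrable_norm_powr[OF assms(1), of "real_of_ereal p"] finite_exponent[OF assms(2,3)] assms
    continuous_measurable_on_interval[OF assms(1)]
  by (auto simp: Lp_space_def)

lemma measure_lebesgue_on_interval: "T > 0 \<Longrightarrow> measure (lebesgue_on {0..T}) {0..T} = T"
  by (simp add: measure_restrict_space)

lemma LINT_one_interval: "T > 0 \<Longrightarrow> (LINT t|lebesgue_on {0..T}. (1::real)) = T"
  using measure_lebesgue_on_interval[of T] by (simp add: space_restrict_space)

text \<open>The embedding of \<open>L\<^sup>p\<close> into \<open>L\<^sup>1\<close> on a bounded
  interval. It follows from integrating \<open>x \<le> 1 + x powr s\<close> for
  \<open>x = norm (y t) / N\<close>, where \<open>N\<close> is the norm, which explains the constant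
  \<open>T + 1\<close>; \<open>N = 0\<close> is separate because of the division. It gives access to
  almost-everywhere convergent subsequences and to bounds for the integral cost.\<close>

lemma LINT_norm_le_Lp_norm:
  fixes y :: "real \<Rightarrow> 'b::euclidean_space"
  assumes T: "T > 0" and p: "1 < p" "p \<noteq> \<infinity>" and y: "y \<in> Lp_space p T"
  shows "integrable (lebesgue_on {0..T}) (\<lambda>t. norm (y t))"
    and "(LINT t|lebesgue_on {0..T}. norm (y t)) \<le> (T + 1) * Lp_norm p T y"
proof -
  let ?M = "lebesgue_on {0..T}"
  define s where "s = real_of_ereal p"
  have s: "s > 1" using finite_exponent[OF p] by (simp add: s_def)
  have ym [measurable]: "y \<in> borel_measurable ?M"
    and yi: "integrable ?M (\<lambda>t. norm (y t) powr s)"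
    using y p by (auto simp: Lp_space_def s_def)
  have i1: "integrable ?M (\<lambda>t. 1 :: real)"
    by (rule continuous_imp_integrable_real) auto
  \<comment> \<open>Scaling this inequality by the norm replaces Hoelder's inequality.\<close>
  have le: "x \<le> 1 + x powr s" if "x \<ge> 0" for x :: real
  proof (cases "x \<le> 1")
    case False
    then have "x powr 1 \<le> x powr s" using s by (intro powr_mono) auto
    then show ?thesis using False by simp
  qed (simp add: add_increasing2)
  have sc: "norm (y t) \<le> c * (1 + c powr (- s) * norm (y t) powr s)" if "c > 0" for c t
  proof -
    have "norm (y t) / c \<le> 1 + (norm (y t) / c) powr s" using that by (intro le) auto
    also have "(norm (y t) / c) powr s = c powr (- s) * norm (y t) powr s"
      using that by (simp add: powr_divide powr_minus field_simps)
    finally show ?thesis using that by (simp add: field_simps)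
  qed
  have ib: "integrable ?M (\<lambda>t. c * (1 + c powr (- s) * norm (y t) powr s))" for c
    using yi i1 by (intro integrable_mult_right Bochner_Integration.integrable_add)
  show int: "integrable ?M (\<lambda>t. norm (y t))"
    by (rule Bochner_Integration.integrable_bound[OF ib[of 1]]) (use sc[of 1] in auto)
  define N where "N = Lp_norm p T y"
  have N: "N powr s = (LINT t|?M. norm (y t) powr s)"
    using Lp_norm_finite_powr[OF p] by (simp add: N_def s_def)
  have N0: "N \<ge> 0" using Lp_norm_finite_nonneg p by (simp add: N_def)
  show "(LINT t|?M. norm (y t)) \<le> (T + 1) * Lp_norm p T y"
  proof (cases "N = 0")
    case True
    then have "(LINT t|?M. norm (y t) powr s) = 0" using N s by simp
    then have "AE t in ?M. norm (y t) powr s = 0"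
      using integral_nonneg_eq_0_iff_AE[OF yi] by simp
    then have "AE t in ?M. norm (y t) = 0" by (rule AE_mp) auto
    then have "(LINT t|?M. norm (y t)) = (LINT t|?M. 0)" by (intro integral_cong_AE) auto
    then show ?thesis using True by (simp add: N_def)
  next
    case False
    then have Np: "N > 0" using N0 by simp
    have "(LINT t|?M. norm (y t)) \<le> (LINT t|?M. N * (1 + N powr (- s) * norm (y t) powr s))"
      using sc[OF Np] by (intro integral_mono int ib) auto
    also have "\<dots> = N * (T + N powr (- s) * N powr s)"
      using i1 yi LINT_one_interval[OF T] by (simp add: N Bochner_Integration.integral_add)
    also have "\<dots> = N * (T + 1)" using Np by (simp add: powr_minus field_simps)
    finally show ?thesis by (simp add: N_def mult.commute)
  qed
qed

lemma LINT_norm_le_Lp_norm_continuous: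
  fixes y :: "real \<Rightarrow> 'b::euclidean_space"
  assumes T: "T > 0" and p: "1 < p" and y: "continuous_on {0..T} y"
  shows "(LINT t|lebesgue_on {0..T}. norm (y t)) \<le> (T + 1) * Lp_norm p T y"
proof (cases "p = \<infinity>")
  case True
  obtain t where t: "t \<in> {0..T}" "Lp_norm \<infinity> T y = norm (y t)" "\<forall>s\<in>{0..T}. norm (y s) \<le> norm (y t)"
    using Lp_norm_infinity_continuous[OF T y] by blast
  have "(LINT t|lebesgue_on {0..T}. norm (y t)) \<le> (LINT s|lebesgue_on {0..T}. norm (y t) * 1)"
    using t(3) by (intro integral_mono continuous_imp_integrable_real continuous_intros y)
      (auto simp: space_restrict_space)
  also have "\<dots> = norm (y t) * T" using T by (simp add: LINT_one_interval measure_lebesgue_on_interval space_restrict_space)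
  also have "\<dots> \<le> (T + 1) * norm (y t)" by (simp add: algebra_simps)
  finally show ?thesis using t(2) True by simp
qed (use LINT_norm_le_Lp_norm(2)[OF T p _ continuous_in_Lp_space[OF y p]] in simp)

text \<open>The two codomains may differ: real constraint values are compared with differences of
  states, and differences of states with the constant 1.\<close>

lemma Lp_norm_mono:
  fixes y :: "real \<Rightarrow> 'b::euclidean_space" and z :: "real \<Rightarrow> 'c::euclidean_space"
  assumes T: "T > 0" and p: "1 < p" and y: "continuous_on {0..T} y" and z: "continuous_on {0..T} z"
    and C: "C \<ge> 0" and le: "\<And>t. t \<in> {0..T} \<Longrightarrow> norm (y t) \<le> C * norm (z t)"
  shows "Lp_norm p T y \<le> C * Lp_norm p T z"
proof (cases "p = \<infinity>")
  case True
  obtain t where t: "t \<in> {0..T}" "Lp_norm \<infinity> T y = norm (y t)"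
    using Lp_norm_infinity_continuous[OF T y] by blast
  obtain r where r: "Lp_norm \<infinity> T z = norm (z r)" "\<forall>s\<in>{0..T}. norm (z s) \<le> norm (z r)"
    using Lp_norm_infinity_continuous[OF T z] by blast
  have "norm (y t) \<le> C * norm (z t)" using le t(1) by simp
  also have "\<dots> \<le> C * norm (z r)" using r(2) t(1) C by (intro mult_left_mono) auto
  finally show ?thesis using t r True by simp
next
  case False
  define s where "s = real_of_ereal p"
  have s: "s > 1" using finite_exponent[OF p False] by (simp add: s_def)
  have "Lp_norm p T y powr s \<le> (LINT t|lebesgue_on {0..T}. C powr s * norm (z t) powr s)"
    unfolding s_def Lp_norm_finite_powr[OF p False]
  proof (intro integral_mono integrable_mult_right)
    show "norm (y t) powr real_of_ereal p \<le> C powr real_of_ereal p * norm (z t) powr real_of_ereal p"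
      if "t \<in> space (lebesgue_on {0..T})" for t
      using powr_mono2[OF _ _ le[of t], of s] that s C
      by (simp add: space_restrict_space powr_mult s_def)
  qed (use s in \<open>auto simp: s_def intro!: integrable_norm_powr y z\<close>)
  also have "\<dots> = C powr s * Lp_norm p T z powr s"
    using Lp_norm_finite_powr[OF p False, of T z] by (simp add: s_def)
  also have "\<dots> = (C * Lp_norm p T z) powr s"
    using C Lp_norm_finite_nonneg[OF False] by (simp add: powr_mult)
  finally show ?thesis
    using s C Lp_norm_finite_nonneg[OF False, of T y] Lp_norm_finite_nonneg[OF False, of T z]
    by (metis less_trans linorder_not_le mult_nonneg_nonneg powr_less_mono2 zero_less_one)
qed

lemma Lp_norm_eq_0_iff:
  fixes y :: "real \<Rightarrow> 'b::euclidean_space"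
  assumes T: "T > 0" and p: "1 < p" and y: "continuous_on {0..T} y"
  shows "Lp_norm p T y = 0 \<longleftrightarrow> (\<forall>t\<in>{0..T}. y t = 0)"
proof
  assume z: "Lp_norm p T y = 0"
  show "\<forall>t\<in>{0..T}. y t = 0"
  proof (cases "p = \<infinity>")
    case True
    then show ?thesis using Lp_norm_infinity_continuous[OF T y] z by auto
  next
    case False
    let ?M = "lebesgue_on {0..T}"
    have i: "integrable ?M (\<lambda>t. norm (y t))"
      using LINT_norm_le_Lp_norm(1)[OF T p False continuous_in_Lp_space[OF y p False]] .
    have "(LINT t|?M. norm (y t)) \<le> 0"
      using LINT_norm_le_Lp_norm_continuous[OF T p y] z by simp
    moreover have "(LINT t|?M. norm (y t)) \<ge> 0" by (intro integral_nonneg_AE) auto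
    ultimately have "AE t in ?M. norm (y t) = 0"
      using integral_nonneg_eq_0_iff_AE[OF i] by simp
    then have ae: "AE t in ?M. norm (y t) \<le> 0" by simp
    have "norm (y t) \<le> 0" if "t \<in> {0..T}" for t
      by (rule AE_le_imp_le_of_continuous[OF T _ ae that]) (intro continuous_intros y)
    then show ?thesis by simp
  qed
next
  assume "\<forall>t\<in>{0..T}. y t = 0"
  then have "Lp_norm p T y \<le> 0 * Lp_norm p T y" using T p y by (intro Lp_norm_mono) auto
  then show "Lp_norm p T y = 0" using Lp_norm_nonneg[OF T y, of p] by simp
qed

text \<open>Minkowski's inequality by normalisation: with norms \<open>a\<close> and
  \<open>b\<close>, the sum \<open>norm (y t) + norm (z t)\<close> is \<open>a + b\<close> times a
  convex combination of \<open>norm (y t) / a\<close> and \<open>norm (z t) / b\<close>, whose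
  powers integrate to 1. Zero norms, where the scaling fails, and \<open>p = \<infinity>\<close> are
  separate.\<close>

lemma Lp_norm_triangle:
  fixes y z :: "real \<Rightarrow> 'b::euclidean_space"
  assumes T: "T > 0" and p: "1 < p" and y: "continuous_on {0..T} y" and z: "continuous_on {0..T} z"
  shows "Lp_norm p T (\<lambda>t. y t + z t) \<le> Lp_norm p T y + Lp_norm p T z"
proof -
  have yz: "continuous_on {0..T} (\<lambda>t. y t + z t)" by (intro continuous_intros y z)
  have nn: "Lp_norm p T y \<ge> 0" "Lp_norm p T z \<ge> 0" "Lp_norm p T (\<lambda>t. y t + z t) \<ge> 0"
    using Lp_norm_nonneg[OF T] y z yz by blast+
  consider "p = \<infinity>" | "p \<noteq> \<infinity>" "Lp_norm p T y = 0" | "p \<noteq> \<infinity>" "Lp_norm p T z = 0"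
    | "p \<noteq> \<infinity>" "Lp_norm p T y > 0" "Lp_norm p T z > 0" using nn by fastforce
  then show ?thesis
  proof cases
    case 1
    obtain t where t: "t \<in> {0..T}" "Lp_norm \<infinity> T (\<lambda>t. y t + z t) = norm (y t + z t)"
      using Lp_norm_infinity_continuous[OF T yz] by blast
    have "norm (y t) \<le> Lp_norm \<infinity> T y" "norm (z t) \<le> Lp_norm \<infinity> T z"
      using norm_le_Lp_norm_infinity[OF T y] norm_le_Lp_norm_infinity[OF T z] t(1) by auto
    then show ?thesis using t(2) norm_triangle_ineq[of "y t" "z t"] 1 by simp
  next
    case 2
    then have "\<forall>t\<in>{0..T}. y t = 0" using Lp_norm_eq_0_iff[OF T p y] by simp
    then have "Lp_norm p T (\<lambda>t. y t + z t) \<le> 1 * Lp_norm p T z"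
      by (intro Lp_norm_mono T p yz z) auto
    then show ?thesis using 2 by simp
  next
    case 3
    then have "\<forall>t\<in>{0..T}. z t = 0" using Lp_norm_eq_0_iff[OF T p z] by simp
    then have "Lp_norm p T (\<lambda>t. y t + z t) \<le> 1 * Lp_norm p T y"
      by (intro Lp_norm_mono T p yz y) auto
    then show ?thesis using 3 by simp
  next
    case 4
    let ?M = "lebesgue_on {0..T}"
    define s where "s = real_of_ereal p"
    have s: "s > 1" using finite_exponent[OF p 4(1)] by (simp add: s_def)
    define a where "a = Lp_norm p T y"
    define b where "b = Lp_norm p T z"
    have ab: "a > 0" "b > 0" using 4 by (auto simp: a_def b_def)
    define u where "u = a / (a + b)"
    define v where "v = b / (a + b)"
    have uv: "u \<ge> 0" "v \<ge> 0" "u + v = 1" using ab by (auto simp: u_def v_def add_divide_distrib[symmetric])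
    have ua: "(a + b) * u = a" and vb: "(a + b) * v = b" using ab by (auto simp: u_def v_def)
    have pt: "norm (y t + z t) powr s
        \<le> (a + b) powr s * (u * (a powr (- s) * norm (y t) powr s) + v * (b powr (- s) * norm (z t) powr s))" for t
    proof -
      have "norm (y t + z t) powr s \<le> (norm (y t) + norm (z t)) powr s"
        using s by (intro powr_mono2 norm_triangle_ineq) auto
      also have "norm (y t) + norm (z t) = (a + b) * (u * (norm (y t) / a) + v * (norm (z t) / b))"
        using ab ua vb by (simp add: distrib_left mult.assoc[symmetric])
      also have "\<dots> powr s = (a + b) powr s * (u * (norm (y t) / a) + v * (norm (z t) / b)) powr s"
        by (rule powr_mult)
      also have "\<dots> \<le> (a + b) powr s * (u * (norm (y t) / a) powr s + v * (norm (z t) / b) powr s)"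
        using ab uv s by (intro mult_left_mono powr_convex_nonneg) auto
      also have "(norm (y t) / a) powr s = a powr (- s) * norm (y t) powr s"
        using ab by (simp add: powr_divide powr_minus field_simps)
      also have "(norm (z t) / b) powr s = b powr (- s) * norm (z t) powr s"
        using ab by (simp add: powr_divide powr_minus field_simps)
      finally show ?thesis .
    qed
    have iy: "integrable ?M (\<lambda>t. norm (y t) powr s)" and iz: "integrable ?M (\<lambda>t. norm (z t) powr s)"
      and iyz: "integrable ?M (\<lambda>t. norm (y t + z t) powr s)"
      using s by (auto intro!: integrable_norm_powr y z yz)
    have "Lp_norm p T (\<lambda>t. y t + z t) powr s = (LINT t|?M. norm (y t + z t) powr s)"
      using Lp_norm_finite_powr[OF p 4(1)] by (simp add: s_def)
    also have "\<dots> \<le> (LINT t|?M. (a + b) powr s *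
        (u * (a powr (- s) * norm (y t) powr s) + v * (b powr (- s) * norm (z t) powr s)))"
      by (intro integral_mono iyz integrable_mult_right Bochner_Integration.integrable_add iy iz pt)
    also have "\<dots> = (a + b) powr s * (u * (a powr (- s) * a powr s) + v * (b powr (- s) * b powr s))"
      using iy iz Lp_norm_finite_powr[OF p 4(1), of T y] Lp_norm_finite_powr[OF p 4(1), of T z]
      by (simp add: a_def b_def s_def)
    also have "\<dots> = (a + b) powr s" using ab uv(3) by (simp add: powr_minus)
    finally show ?thesis
      using s ab nn(3) powr_less_mono2[of s "a + b" "Lp_norm p T (\<lambda>t. y t + z t)"]
      by (force simp: a_def b_def)
  qed
qed

section \<open>Gradients and the maximum of the constraints\<close>

text \<open>Since \<open>gradient\<close> is a definite description, both existence and uniqueness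
  are needed. The Riesz vector \<open>adjoint F' 1\<close> represents the derivative, and testing
  two representing vectors on their difference shows that they agree.\<close>

lemma GDERIV_gradient:
  fixes F :: "'a::euclidean_space \<Rightarrow> real"
  assumes "F differentiable (at x)"
  shows "GDERIV F x :> gradient F x"
proof -
  obtain F' where F': "(F has_derivative F') (at x)"
    using assms by (auto simp: differentiable_def)
  interpret F': linear F' using F' by (rule has_derivative_linear)
  define v where "v = adjoint F' 1"
  have "F' = (\<lambda>h. h \<bullet> v)"
    by (rule ext) (simp add: v_def adjoint_clauses(1)[OF F'.linear_axioms])
  then have v: "GDERIV F x :> v" using F' by (simp add: gderiv_def)
  moreover have "w = v" if "GDERIV F x :> w" for w
  proof -
    have "(\<lambda>h. h \<bullet> w) = (\<lambda>h. h \<bullet> v)"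
      using that v has_derivative_unique unfolding gderiv_def by blast
    then have "(w - v) \<bullet> w = (w - v) \<bullet> v" by (rule fun_cong)
    then have "(w - v) \<bullet> (w - v) = 0" by (simp add: inner_diff_right)
    then show ?thesis by simp
  qed
  ultimately have "gradient F x = v" unfolding gradient_def by (intro the_equality)
  then show ?thesis using v by simp
qed

lemma gradient_mvt:
  fixes F :: "'a::euclidean_space \<Rightarrow> real"
  assumes "\<And>z. F differentiable (at z)"
  shows "\<exists>\<xi>\<in>closed_segment x y. F y - F x = gradient F \<xi> \<bullet> (y - x)"
proof -
  define \<gamma> where "\<gamma> = (\<lambda>r. x + r *\<^sub>R (y - x))"
  have \<gamma>: "(\<gamma> has_derivative (\<lambda>h. h *\<^sub>R (y - x))) (at r)" for r
    unfolding \<gamma>_def by (auto intro!: derivative_eq_intros)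
  have "((\<lambda>r. F (\<gamma> r)) has_derivative (\<lambda>h. (h *\<^sub>R (y - x)) \<bullet> gradient F (\<gamma> r))) (at r)" for r
    using GDERIV_gradient[OF assms, of "\<gamma> r"] \<gamma> unfolding gderiv_def
    by (rule has_derivative_compose[rotated])
  then have D: "((\<lambda>r. F (\<gamma> r)) has_real_derivative gradient F (\<gamma> r) \<bullet> (y - x)) (at r)" for r
    by (rule has_derivative_imp_has_field_derivative) (simp add: inner_commute)
  obtain z where z: "0 < z" "z < 1"
    "F (\<gamma> 1) - F (\<gamma> 0) = (1 - 0) * (gradient F (\<gamma> z) \<bullet> (y - x))"
    using MVT2[of 0 1 "\<lambda>r. F (\<gamma> r)" "\<lambda>r. gradient F (\<gamma> r) \<bullet> (y - x)"] D by auto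
  have "\<gamma> z \<in> closed_segment x y"
    using z by (auto simp: \<gamma>_def closed_segment_def algebra_simps intro!: exI[of _ z])
  then show ?thesis using z by (intro bexI[of _ "\<gamma> z"]) (auto simp: \<gamma>_def)
qed

lemma C1_in_state_D:
  assumes "C1_in_state T F"
  shows "continuous_on (UNIV \<times> {0..T}) (\<lambda>(x, t). F x t)"
    and "t \<in> {0..T} \<Longrightarrow> (\<lambda>y. F y t) differentiable (at x)"
    and "continuous_on (UNIV \<times> {0..T}) (\<lambda>(x, t). gradient (\<lambda>y. F y t) x)"
  using assms by (auto simp: C1_in_state_def)

lemma C1_in_state_zero: "C1_in_state T (\<lambda>x t. 0)"
proof -
  have "gradient (\<lambda>y::'a::euclidean_space. 0) x = 0" for x
  proof -
    have "GDERIV (\<lambda>y::'a. 0) x :> gradient (\<lambda>y. 0) x" by (intro GDERIV_gradient) simp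
    then have "(\<lambda>h. h \<bullet> gradient (\<lambda>y::'a. 0) x) = (\<lambda>h. 0)"
      unfolding gderiv_def using has_derivative_const has_derivative_unique by fast
    then have "gradient (\<lambda>y::'a. 0) x \<bullet> gradient (\<lambda>y::'a. 0) x = 0" by (rule fun_cong)
    then show ?thesis by simp
  qed
  then show ?thesis by (simp add: C1_in_state_def)
qed

text \<open>The gradient is bounded on the compact product \<open>cball 0 R \<times> {0..T}\<close>,
  and convexity of the ball keeps the intermediate point of the mean value theorem inside
  it.\<close>

lemma C1_in_state_Lipschitz:
  fixes F :: "'a::euclidean_space \<Rightarrow> real \<Rightarrow> real"
  assumes "C1_in_state T F"
  shows "\<exists>M\<ge>0. \<forall>x\<in>cball 0 R. \<forall>y\<in>cball 0 R. \<forall>t\<in>{0..T}.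
    norm (gradient (\<lambda>y. F y t) x) \<le> M \<and> \<bar>F y t - F x t\<bar> \<le> M * norm (y - x)"
proof -
  let ?G = "\<lambda>(x, t). gradient (\<lambda>y. F y t) x"
  have "compact (?G ` (cball 0 R \<times> {0..T}))"
    by (intro compact_continuous_image continuous_on_subset[OF C1_in_state_D(3)[OF assms]] compact_Times)
       auto
  then obtain M where M: "M > 0" "\<And>v. v \<in> ?G ` (cball 0 R \<times> {0..T}) \<Longrightarrow> norm v \<le> M"
    using compact_imp_bounded bounded_pos by metis
  have grad: "norm (gradient (\<lambda>y. F y t) x) \<le> M" if "x \<in> cball 0 R" "t \<in> {0..T}" for x t
    using that by (intro M(2)) (auto intro!: image_eqI[of _ _ "(x, t)"])
  have "\<bar>F y t - F x t\<bar> \<le> M * norm (y - x)"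
    if xy: "x \<in> cball 0 R" "y \<in> cball 0 R" and t: "t \<in> {0..T}" for x y t
  proof -
    obtain \<xi> where \<xi>: "\<xi> \<in> closed_segment x y" "F y t - F x t = gradient (\<lambda>y. F y t) \<xi> \<bullet> (y - x)"
      using gradient_mvt[OF C1_in_state_D(2)[OF assms t], of x y] by auto
    have "\<xi> \<in> cball 0 R"
      using \<xi>(1) xy convex_contains_segment[of "cball (0::'a) R"] convex_cball by blast
    then have "norm (gradient (\<lambda>y. F y t) \<xi>) * norm (y - x) \<le> M * norm (y - x)"
      using t by (intro mult_right_mono grad) auto
    then show ?thesis
      using Cauchy_Schwarz_ineq2[of "gradient (\<lambda>y. F y t) \<xi>" "y - x"] \<xi>(2) by simp
  qed
  then show ?thesis using M(1) grad by (intro exI[of _ M]) simp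
qed

lemma continuous_on_along_curve:
  fixes F :: "'a::topological_space \<Rightarrow> real \<Rightarrow> 'b::topological_space"
  assumes "continuous_on (UNIV \<times> {0..T}) (\<lambda>(x, t). F x t)" "continuous_on {0..T} x"
  shows "continuous_on {0..T} (\<lambda>t. F (x t) t)"
proof -
  have "continuous_on {0..T} (\<lambda>t. (case (x t, t) of (x, t) \<Rightarrow> F x t))"
    by (rule continuous_on_compose2[OF assms(1)]) (auto intro!: continuous_intros assms(2))
  then show ?thesis by simp
qed

lemma tendsto_along_sequence:
  fixes F :: "'a::topological_space \<Rightarrow> real \<Rightarrow> 'b::topological_space"
  assumes F: "continuous_on (UNIV \<times> {0..T}) (\<lambda>(x, t). F x t)"
    and X: "X \<longlonglongrightarrow> x" and \<tau>: "\<tau> \<longlonglongrightarrow> t" "\<And>n. \<tau> n \<in> {0..T}" "t \<in> {0..T}"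
  shows "(\<lambda>n. F (X n) (\<tau> n)) \<longlonglongrightarrow> F x t"
proof -
  have "(\<lambda>n. (X n, \<tau> n)) \<longlonglongrightarrow> (x, t)" by (intro tendsto_Pair X \<tau>)
  then have "(\<lambda>n. (case (X n, \<tau> n) of (x, t) \<Rightarrow> F x t)) \<longlonglongrightarrow> (case (x, t) of (x, t) \<Rightarrow> F x t)"
    by (rule continuous_on_tendsto_compose[OF F]) (use \<tau> in auto)
  then show ?thesis by simp
qed

text \<open>Base points and times may vary with \<open>n\<close>, as they do for
  \<open>p = \<infinity>\<close>, where the quotient is taken at moving maximisers. The intermediate
  points of the mean value theorem tend to \<open>x\<close>, and the gradient is jointly continuous
  in state and time.\<close>

lemma C1_in_state_quotient_tendsto:
  fixes F :: "'a::euclidean_space \<Rightarrow> real \<Rightarrow> real"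
  assumes C1: "C1_in_state T F"
    and X: "X \<longlonglongrightarrow> x" "Y \<longlonglongrightarrow> x" and \<tau>: "\<tau> \<longlonglongrightarrow> t" "\<And>n. \<tau> n \<in> {0..T}" "t \<in> {0..T}"
    and h: "(\<lambda>n. (Y n - X n) /\<^sub>R q n) \<longlonglongrightarrow> h"
  shows "(\<lambda>n. (F (Y n) (\<tau> n) - F (X n) (\<tau> n)) / q n) \<longlonglongrightarrow> gradient (\<lambda>y. F y t) x \<bullet> h"
proof -
  have "\<exists>\<xi>. \<xi> \<in> closed_segment (X n) (Y n) \<and>
      F (Y n) (\<tau> n) - F (X n) (\<tau> n) = gradient (\<lambda>y. F y (\<tau> n)) \<xi> \<bullet> (Y n - X n)" for n
    using gradient_mvt[OF C1_in_state_D(2)[OF C1 \<tau>(2)], of "X n" "Y n" n] by auto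
  then obtain \<xi> where \<xi>: "\<And>n. \<xi> n \<in> closed_segment (X n) (Y n)"
    "\<And>n. F (Y n) (\<tau> n) - F (X n) (\<tau> n) = gradient (\<lambda>y. F y (\<tau> n)) (\<xi> n) \<bullet> (Y n - X n)"
    by moura
  have "(\<lambda>n. norm (Y n - X n)) \<longlonglongrightarrow> norm (x - x)" by (intro tendsto_intros X)
  then have nrm: "(\<lambda>n. norm (Y n - X n)) \<longlonglongrightarrow> 0" by simp
  have "(\<lambda>n. \<xi> n - X n) \<longlonglongrightarrow> 0"
    by (rule Lim_null_comparison[OF _ nrm])
       (use segment_bound(1)[OF \<xi>(1)] in \<open>auto intro!: always_eventually\<close>)
  from tendsto_add[OF this X(1)] have "\<xi> \<longlonglongrightarrow> x" by simp
  then have "(\<lambda>n. gradient (\<lambda>y. F y (\<tau> n)) (\<xi> n)) \<longlonglongrightarrow> gradient (\<lambda>y. F y t) x"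
    by (rule tendsto_along_sequence[OF C1_in_state_D(3)[OF C1] _ \<tau>])
  from tendsto_inner[OF this h]
  have "(\<lambda>n. gradient (\<lambda>y. F y (\<tau> n)) (\<xi> n) \<bullet> ((Y n - X n) /\<^sub>R q n)) \<longlonglongrightarrow> gradient (\<lambda>y. F y t) x \<bullet> h" .
  then show ?thesis by (simp add: \<xi>(2) divide_inverse mult.commute)
qed

lemma max_constraint_nonneg: "max_constraint l g x t \<ge> 0"
  by (simp add: max_constraint_def)

lemma with_zero_le_max_constraint: "j \<in> {0..l} \<Longrightarrow> with_zero g j x t \<le> max_constraint l g x t"
  unfolding max_constraint_def by (intro Max_ge) (auto simp: with_zero_def)

lemma active_set_nonempty: "active_set l g x t \<noteq> {}"
proof -
  have "max_constraint l g x t \<in> insert 0 ((\<lambda>j. g j x t) ` {1..l})"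
    unfolding max_constraint_def by (rule Max_in) auto
  then consider "max_constraint l g x t = with_zero g 0 x t"
    | j where "j \<in> {1..l}" "max_constraint l g x t = with_zero g j x t"
    by (auto simp: with_zero_def)
  then show ?thesis by cases (auto simp: active_set_def)
qed

lemma C1_in_state_with_zero:
  assumes "\<And>j. j \<in> {1..l} \<Longrightarrow> C1_in_state T (g j)" "j \<in> {0..l}"
  shows "C1_in_state T (with_zero g j)"
proof (cases "j = 0")
  case True
  then have "with_zero g j = (\<lambda>x t. 0)" by (simp add: with_zero_def fun_eq_iff)
  then show ?thesis by (simp add: C1_in_state_zero)
next
  case False
  then have "with_zero g j = g j" by (simp add: with_zero_def fun_eq_iff)
  then show ?thesis using assms False by simp
qed

lemma max_constraint_continuous:
  assumes C1: "\<And>j. j \<in> {1..l} \<Longrightarrow> C1_in_state T (g j)"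
  shows "continuous_on (UNIV \<times> {0..T}) (\<lambda>(x, t). max_constraint l g x t)"
proof -
  have Max_cont: "continuous_on S (\<lambda>z. Max (insert 0 ((\<lambda>j. f j z) ` J)))"
    if "finite J" "\<And>j. j \<in> J \<Longrightarrow> continuous_on S (f j)"
    for S :: "((real^'a) \<times> real) set" and f :: "nat \<Rightarrow> (real^'a) \<times> real \<Rightarrow> real" and J
    using that
  proof (induction J rule: finite_induct)
    case (insert i J)
    have "Max (insert 0 ((\<lambda>j. f j z) ` insert i J)) = max (f i z) (Max (insert 0 ((\<lambda>j. f j z) ` J)))" for z
    proof -
      have "insert 0 ((\<lambda>j. f j z) ` insert i J) = insert (f i z) (insert 0 ((\<lambda>j. f j z) ` J))" by auto
      then show ?thesis using insert.hyps by (simp only: Max_insert[of "insert 0 ((\<lambda>j. f j z) ` J)"]) simp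
    qed
    then show ?case using insert by (simp add: continuous_on_max)
  qed simp
  have "continuous_on (UNIV \<times> {0..T}) (\<lambda>z. Max (insert 0 ((\<lambda>j. (case z of (x, t) \<Rightarrow> g j x t)) ` {1..l})))"
    by (rule Max_cont) (use C1_in_state_D(1)[OF C1] in auto)
  then show ?thesis by (simp add: max_constraint_def case_prod_unfold)
qed

text \<open>An index attaining the maximum at \<open>y\<close> bounds the increment from above by
  the increment of one function; exchanging the points gives the absolute value. The sum of the
  individual constants serves all indices.\<close>

lemma constraints_Lipschitz:
  fixes g :: "nat \<Rightarrow> real^'d \<Rightarrow> real \<Rightarrow> real"
  assumes C1: "\<And>j. j \<in> {1..l} \<Longrightarrow> C1_in_state T (g j)"
  shows "\<exists>M\<ge>0. \<forall>x\<in>cball 0 R. \<forall>y\<in>cball 0 R. \<forall>t\<in>{0..T}.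
      \<bar>max_constraint l g y t - max_constraint l g x t\<bar> \<le> M * norm (y - x)"
proof -
  have "\<forall>j\<in>{0..l}. \<exists>M\<ge>0. \<forall>x\<in>cball 0 R. \<forall>y\<in>cball 0 R. \<forall>t\<in>{0..T}.
      \<bar>with_zero g j y t - with_zero g j x t\<bar> \<le> M * norm (y - x)"
  proof
    fix j assume "j \<in> {0..l}"
    then have "C1_in_state T (with_zero g j)" by (rule C1_in_state_with_zero[rotated]) (rule C1)
    from C1_in_state_Lipschitz[OF this, of R] obtain M where "M \<ge> 0"
      "\<And>x y t. x \<in> cball 0 R \<Longrightarrow> y \<in> cball 0 R \<Longrightarrow> t \<in> {0..T} \<Longrightarrow>
        \<bar>with_zero g j y t - with_zero g j x t\<bar> \<le> M * norm (y - x)" by auto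
    then show "\<exists>M\<ge>0. \<forall>x\<in>cball 0 R. \<forall>y\<in>cball 0 R. \<forall>t\<in>{0..T}.
      \<bar>with_zero g j y t - with_zero g j x t\<bar> \<le> M * norm (y - x)" by (intro exI[of _ M]) simp
  qed
  from bchoice[OF this] obtain m where "\<forall>j\<in>{0..l}. m j \<ge> 0 \<and> (\<forall>x\<in>cball 0 R. \<forall>y\<in>cball 0 R. \<forall>t\<in>{0..T}.
      \<bar>with_zero g j y t - with_zero g j x t\<bar> \<le> m j * norm (y - x))" by (elim exE)
  then have m: "\<And>j. j \<in> {0..l} \<Longrightarrow> m j \<ge> 0"
    "\<And>j x y t. j \<in> {0..l} \<Longrightarrow> x \<in> cball 0 R \<Longrightarrow> y \<in> cball 0 R \<Longrightarrow> t \<in> {0..T} \<Longrightarrow>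
      \<bar>with_zero g j y t - with_zero g j x t\<bar> \<le> m j * norm (y - x)" by simp_all
  define M where "M = sum m {0..l}"
  have mM: "m j \<le> M" if "j \<in> {0..l}" for j
    unfolding M_def using that m(1) by (intro member_le_sum) auto
  have one: "max_constraint l g y t - max_constraint l g x t \<le> M * norm (y - x)"
    if xy: "x \<in> cball 0 R" "y \<in> cball 0 R" and t: "t \<in> {0..T}" for x y t
  proof -
    obtain j where j: "j \<in> {0..l}" "max_constraint l g y t = with_zero g j y t"
      using active_set_nonempty[of l g y t] by (auto simp: active_set_def)
    have "max_constraint l g y t - max_constraint l g x t \<le> with_zero g j y t - with_zero g j x t"
      using j(2) with_zero_le_max_constraint[OF j(1), of g x t] by simp
    also have "\<dots> \<le> m j * norm (y - x)" using m(2)[OF j(1) xy t] by simp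
    also have "\<dots> \<le> M * norm (y - x)" using mM[OF j(1)] by (intro mult_right_mono) auto
    finally show ?thesis .
  qed
  have "\<bar>max_constraint l g y t - max_constraint l g x t\<bar> \<le> M * norm (y - x)"
    if "x \<in> cball 0 R" "y \<in> cball 0 R" "t \<in> {0..T}" for x y t
    using one[OF that] one[OF that(2,1,3)] by (simp add: abs_le_iff norm_minus_commute)
  moreover have "M \<ge> 0" unfolding M_def using m(1) by (intro sum_nonneg) auto
  ultimately show ?thesis by (intro exI[of _ M]) simp
qed

text \<open>
  Along the sequence only constraints active at \<open>x\<close> can be active infinitely often.  Taking the
  maximum with \<open>D\<close> turns the upper bound on the limes superior into a limit.
\<close>

lemma max_constraint_quotient_limit:
  fixes g :: "nat \<Rightarrow> real^'d \<Rightarrow> real \<Rightarrow> real"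
  assumes C1: "\<And>j. j \<in> {1..l} \<Longrightarrow> C1_in_state T (g j)" and t: "t \<in> {0..T}"
    and X: "X \<longlonglongrightarrow> x" and h: "(\<lambda>n. (X n - x) /\<^sub>R q n) \<longlonglongrightarrow> h"
  defines "D \<equiv> (SUP v\<in>subdiff l g x t. v \<bullet> h)"
  shows "(\<lambda>n. max ((max_constraint l g (X n) t - max_constraint l g x t) / q n) D) \<longlonglongrightarrow> D"
proof -
  have subset: "gradient (\<lambda>y. with_zero g j y t) x \<in> subdiff l g x t" if "j \<in> active_set l g x t" for j
    unfolding subdiff_def using that by (intro hull_inc) simp
  \<comment> \<open>A real-valued \<open>SUP\<close> dominates its elements only over a set bounded
    above; compactness of the hull of finitely many gradients ensures this.\<close>
  have "finite (active_set l g x t)" by (simp add: active_set_def)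
  then have "compact (subdiff l g x t)"
    unfolding subdiff_def by (intro compact_convex_hull finite_imp_compact finite_imageI)
  then have "bdd_above ((\<lambda>v. v \<bullet> h) ` subdiff l g x t)"
    by (intro bounded_imp_bdd_above compact_imp_bounded compact_continuous_image continuous_intros)
  then have leD: "gradient (\<lambda>y. with_zero g j y t) x \<bullet> h \<le> D" if "j \<in> active_set l g x t" for j
    unfolding D_def by (rule cSUP_upper[OF subset[OF that]])
  have cont_w: "(\<lambda>n. with_zero g j (X n) t) \<longlonglongrightarrow> with_zero g j x t" if "j \<in> {0..l}" for j
    by (rule tendsto_along_sequence[OF C1_in_state_D(1)[OF C1_in_state_with_zero[OF C1 that]] X])
       (use t in auto)
  have cont_c: "(\<lambda>n. max_constraint l g (X n) t) \<longlonglongrightarrow> max_constraint l g x t"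
    by (rule tendsto_along_sequence[OF max_constraint_continuous[OF C1] X]) (use t in auto)
  have ev: "eventually (\<lambda>n. (max_constraint l g (X n) t - max_constraint l g x t) / q n < D + e) sequentially"
    if e: "e > 0" for e
  proof -
    have "\<forall>j\<in>{0..l}. eventually (\<lambda>n. max_constraint l g (X n) t = with_zero g j (X n) t \<longrightarrow>
        (max_constraint l g (X n) t - max_constraint l g x t) / q n < D + e) sequentially"
    proof
      fix j assume j: "j \<in> {0..l}"
      show "eventually (\<lambda>n. max_constraint l g (X n) t = with_zero g j (X n) t \<longrightarrow>
        (max_constraint l g (X n) t - max_constraint l g x t) / q n < D + e) sequentially"
      proof (cases "j \<in> active_set l g x t")
        case True
        then have eq: "max_constraint l g x t = with_zero g j x t" by (simp add: active_set_def)
        have "(\<lambda>n. (with_zero g j (X n) t - with_zero g j x t) / q n)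
            \<longlonglongrightarrow> gradient (\<lambda>y. with_zero g j y t) x \<bullet> h"
          by (rule C1_in_state_quotient_tendsto[where X = "\<lambda>n. x" and \<tau> = "\<lambda>n. t"])
             (use X h t j C1_in_state_with_zero[OF C1] in auto)
        then have "eventually (\<lambda>n. (with_zero g j (X n) t - with_zero g j x t) / q n < D + e) sequentially"
          by (rule order_tendstoD(2)) (use leD[OF True] e in simp)
        then show ?thesis by (rule eventually_mono) (simp add: eq)
      next
        case False
        then have "with_zero g j x t < max_constraint l g x t"
          using j with_zero_le_max_constraint[OF j, of g x t] by (auto simp: active_set_def)
        then have "eventually (\<lambda>n. max_constraint l g (X n) t - with_zero g j (X n) t > 0) sequentially"
          using tendsto_diff[OF cont_c cont_w[OF j]] by (intro order_tendstoD(1)) auto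
        then show ?thesis by (rule eventually_mono) auto
      qed
    qed
    then have "eventually (\<lambda>n. \<forall>j\<in>{0..l}. max_constraint l g (X n) t = with_zero g j (X n) t \<longrightarrow>
        (max_constraint l g (X n) t - max_constraint l g x t) / q n < D + e) sequentially"
      by (intro eventually_ball_finite) auto
    then show ?thesis
    proof (rule eventually_mono)
      fix n assume *: "\<forall>j\<in>{0..l}. max_constraint l g (X n) t = with_zero g j (X n) t \<longrightarrow>
        (max_constraint l g (X n) t - max_constraint l g x t) / q n < D + e"
      obtain j where "j \<in> {0..l}" "max_constraint l g (X n) t = with_zero g j (X n) t"
        using active_set_nonempty[of l g "X n" t] by (auto simp: active_set_def)
      then show "(max_constraint l g (X n) t - max_constraint l g x t) / q n < D + e" using * by simp
    qed
  qed
  show ?thesis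
  proof (rule tendstoI)
    fix e :: real assume "e > 0"
    from ev[OF this] show "eventually (\<lambda>n.
        dist (max ((max_constraint l g (X n) t - max_constraint l g x t) / q n) D) D < e) sequentially"
      by (rule eventually_mono) (use \<open>e > 0\<close> in \<open>simp add: dist_real_def max_def\<close>)
  qed
qed

section \<open>The descent rate of the penalty term\<close>

lemma bounded_max_constraint:
  fixes g :: "nat \<Rightarrow> real^'d \<Rightarrow> real \<Rightarrow> real"
  assumes C1: "\<And>j. j \<in> {1..l} \<Longrightarrow> C1_in_state T (g j)"
  shows "\<exists>B. \<forall>x\<in>cball 0 R. \<forall>t\<in>{0..T}. max_constraint l g x t \<le> B"
proof -
  let ?c = "\<lambda>(x, t). max_constraint l g x t"
  have "compact (?c ` (cball 0 R \<times> {0..T}))"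
    by (intro compact_continuous_image compact_Times
        continuous_on_subset[OF max_constraint_continuous[OF C1]]) auto
  then have "bdd_above (?c ` (cball 0 R \<times> {0..T}))"
    by (intro bounded_imp_bdd_above compact_imp_bounded)
  then show ?thesis by (auto simp: bdd_above_def)
qed

text \<open>The bound \<open>R\<close> confines all curves to one ball, so that a common Lipschitz
  constant and a common bound for the constraint maximum are available. The index \<open>m\<close>
  is free, which lets the resulting point be taken arbitrarily close to \<open>x\<close>.\<close>

lemma slope_finite_exponent:
  fixes g :: "nat \<Rightarrow> real^'d \<Rightarrow> real \<Rightarrow> real"
  assumes T: "T > 0" and p: "1 < p" "p \<noteq> \<infinity>"
    and C1: "\<And>j. j \<in> {1..l} \<Longrightarrow> C1_in_state T (g j)"
    and x: "continuous_on {0..T} x" "\<And>t. t \<in> {0..T} \<Longrightarrow> norm (x t) \<le> R"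
    and X: "\<And>n. continuous_on {0..T} (X n)" "\<And>n t. t \<in> {0..T} \<Longrightarrow> norm (X n t) \<le> R"
    and lim: "\<And>t. t \<in> {0..T} \<Longrightarrow> (\<lambda>n. X n t) \<longlonglongrightarrow> x t"
    and q: "\<And>n. q n > 0"
    and h: "Lp_tendsto p T (\<lambda>n t. (X n t - x t) /\<^sub>R q n) h"
    and N: "penalty_term p T l g x > 0" and a: "a > 0"
    and descent: "descent_condition p T l g a x h"
  shows "\<exists>n\<ge>m. penalty_term p T l g (X n) \<le> penalty_term p T l g x - a / 2 * q n"
proof -
  let ?M = "lebesgue_on {0..T}"
  define s where "s = real_of_ereal p"
  have s: "s > 1" using finite_exponent[OF p] by (simp add: s_def)
  define c where "c = (\<lambda>t. max_constraint l g (x t) t)"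
  define C where "C = (\<lambda>n t. max_constraint l g (X n t) t)"
  define H where "H = (\<lambda>n t. (X n t - x t) /\<^sub>R q n)"
  define D where "D = (\<lambda>t. SUP v\<in>subdiff l g (x t) t. v \<bullet> h t)"
  define E where "E = (\<lambda>t. c t powr (s - 1) * D t)"
  define P where "P = penalty_term p T l g x"
  define Q where "Q = (\<lambda>n. penalty_term p T l g (X n))"
  have c: "continuous_on {0..T} c" and C: "\<And>n. continuous_on {0..T} (C n)"
    unfolding c_def C_def
    by (intro continuous_on_along_curve[OF max_constraint_continuous[OF C1]] x X; assumption)+
  have c0: "c t \<ge> 0" and C0: "C n t \<ge> 0" for n t
    by (auto simp: c_def C_def max_constraint_nonneg)
  have H: "continuous_on {0..T} (H n)" for n
    unfolding H_def by (intro continuous_intros X x)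
  have hL: "h \<in> Lp_space p T" and Hh: "(\<lambda>n. Lp_norm p T (\<lambda>t. H n t - h t)) \<longlonglongrightarrow> 0"
    using h by (auto simp: Lp_tendsto_def H_def)
  have hm [measurable]: "h \<in> borel_measurable ?M" using hL by (simp add: Lp_space_def)
  have Hm [measurable]: "H n \<in> borel_measurable ?M" for n
    by (rule continuous_measurable_on_interval[OF H])
  have HhL: "(\<lambda>t. H n t - h t) \<in> Lp_space p T" for n
  proof -
    have "integrable ?M (\<lambda>t. norm (H n t - h t) powr s)"
    proof (rule Bochner_Integration.integrable_bound)
      show "integrable ?M (\<lambda>t. 2 powr s * (norm (H n t) powr s + norm (h t) powr s))"
        using hL p s integrable_norm_powr[OF H, of s n]
        by (intro integrable_mult_right Bochner_Integration.integrable_add)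
           (auto simp: Lp_space_def s_def)
      have "norm (H n t - h t) powr s \<le> 2 powr s * (norm (H n t) powr s + norm (h t) powr s)" for t
      proof -
        have "norm (H n t - h t) powr s \<le> (norm (H n t) + norm (h t)) powr s"
          using s by (intro powr_mono2 norm_triangle_ineq4) auto
        also have "\<dots> \<le> 2 powr s * (norm (H n t) powr s + norm (h t) powr s)"
          using s by (intro powr_add_le) auto
        finally show ?thesis .
      qed
      then show "AE t in ?M. norm (norm (H n t - h t) powr s)
          \<le> norm (2 powr s * (norm (H n t) powr s + norm (h t) powr s))"
        by (intro AE_I2) (simp add: abs_mult)
    qed measurable
    then show ?thesis using p by (simp add: Lp_space_def s_def)
  qed
  note L1 = LINT_norm_le_Lp_norm[OF T p]
  have hi: "integrable ?M (\<lambda>t. norm (h t))" by (rule L1(1)[OF hL])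
  have di: "integrable ?M (\<lambda>t. norm (H n t - h t))" for n by (rule L1(1)[OF HhL])
  have d0: "(\<lambda>n. LINT t|?M. norm (H n t - h t)) \<longlonglongrightarrow> 0"
  proof (rule tendsto_sandwich[where f = "\<lambda>n. 0"])
    show "eventually (\<lambda>n. (LINT t|?M. norm (H n t - h t)) \<le> (T + 1) * Lp_norm p T (\<lambda>t. H n t - h t)) sequentially"
      using L1(2)[OF HhL] by simp
    show "(\<lambda>n. (T + 1) * Lp_norm p T (\<lambda>t. H n t - h t)) \<longlonglongrightarrow> 0"
      using tendsto_mult_right_zero[OF Hh] .
  qed (auto intro!: always_eventually integral_nonneg_AE)
  have di': "integrable ?M (\<lambda>t. H n t - h t)" for n
    by (rule iffD1[OF integrable_norm_iff di]) measurable
  \<comment> \<open>Convergence of \<open>H n\<close> in \<open>L\<^sup>p\<close> is passed to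
    \<open>L\<^sup>1\<close> in order to extract a subsequence converging at almost every time,
    where the directional estimate of the constraint maximum can be applied.\<close>
  obtain r where r: "strict_mono r" "AE t in ?M. (\<lambda>n. H (r n) t - h t) \<longlonglongrightarrow> 0"
    using tendsto_L1_AE_subseq[of ?M "\<lambda>n t. H n t - h t", OF di' d0] by blast
  obtain M where M: "M \<ge> 0" "\<And>y z t. norm y \<le> R \<Longrightarrow> norm z \<le> R \<Longrightarrow> t \<in> {0..T} \<Longrightarrow>
      \<bar>max_constraint l g z t - max_constraint l g y t\<bar> \<le> M * norm (z - y)"
    using constraints_Lipschitz[of l T g R, OF C1] by auto
  have "\<exists>B. \<forall>x\<in>cball 0 R. \<forall>t\<in>{0..T}. max_constraint l g x t \<le> B"
    by (rule bounded_max_constraint) (rule C1)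
  then obtain B where "\<forall>x\<in>cball 0 R. \<forall>t\<in>{0..T}. max_constraint l g x t \<le> B" by (elim exE)
  then have B: "\<And>y t. norm y \<le> R \<Longrightarrow> t \<in> {0..T} \<Longrightarrow> max_constraint l g y t \<le> B" by simp
  define K where "K = B powr (s - 1) * M"
  have K: "K \<ge> 0" using M by (simp add: K_def)
  \<comment> \<open>This is the right-hand side of the pointwise tangent inequality at the new value
    \<open>C n t\<close>, divided by \<open>s * q n\<close>.\<close>
  define u where "u = (\<lambda>n t. C n t powr (s - 1) * ((C n t - c t) / q n))"
  \<comment> \<open>\<open>u n\<close> is dominated only by \<open>K * norm (H n t)\<close>, which varies with \<open>n\<close>; the correction makes
    \<open>K * norm (h t)\<close> an upper bound and vanishes in \<open>L\<^sup>1\<close>.\<close>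
  define \<rho> where "\<rho> = (\<lambda>n t. u n t - K * norm (H n t - h t))"
  have u_le: "u n t \<le> K * norm (H n t)" if t: "t \<in> {0..T}" for n t
  proof -
    have "(C n t - c t) / q n \<le> M * norm (X n t - x t) / q n"
      using M(2)[OF x(2)[OF t] X(2)[OF t, of n] t] q[of n]
      by (intro divide_right_mono) (auto simp: C_def c_def)
    also have "\<dots> = M * norm (H n t)" using q[of n] by (simp add: H_def divide_inverse mult.commute)
    finally have 1: "(C n t - c t) / q n \<le> M * norm (H n t)" .
    have "C n t powr (s - 1) \<le> B powr (s - 1)"
      using B[OF X(2)[OF t] t] C0 s by (intro powr_mono2) (auto simp: C_def)
    then have "C n t powr (s - 1) * (M * norm (H n t)) \<le> B powr (s - 1) * (M * norm (H n t))"
      using M(1) by (intro mult_right_mono) auto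
    moreover have "u n t \<le> C n t powr (s - 1) * (M * norm (H n t))"
      unfolding u_def using 1 by (intro mult_left_mono) auto
    ultimately show ?thesis by (simp add: K_def mult.assoc)
  qed
  have ui: "integrable ?M (u n)" for n
    unfolding u_def using q[of n] s C0
    by (intro continuous_imp_integrable_real continuous_intros continuous_on_powr' c C) auto
  have \<rho>i: "integrable ?M (\<rho> n)" for n
    unfolding \<rho>_def by (intro Bochner_Integration.integrable_diff integrable_mult_right ui di)
  have LE: "(LINT t|?M. E t) \<le> - a * P powr (s - 1)"
  proof -
    have "(LINT t:{0..T}|lebesgue. c t powr (s - 1) * D t) \<le> - a * P powr (s - 1)"
      using descent p by (simp add: descent_condition_def c_def D_def P_def s_def)
    then show ?thesis
      by (simp add: E_def integral_restrict_space set_lebesgue_integral_def)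
  qed
  have Pp: "P powr (s - 1) > 0" using N by (simp add: P_def)
  \<comment> \<open>\<open>D\<close> is not known to be measurable, but the integral of a non-integrable function is \<open>0\<close>,
    which contradicts the bound.\<close>
  have Ei: "integrable ?M E"
  proof (rule ccontr)
    assume "\<not> integrable ?M E"
    then have "(LINT t|?M. E t) = 0" by (rule not_integrable_integral_eq)
    then show False using LE mult_pos_pos[OF a Pp] by simp
  qed
  \<comment> \<open>Squeezed between \<open>E t\<close> and a bound in which the quotient is
    replaced by its maximum with \<open>D t\<close>. The weights
    \<open>C (r n) t powr (s - 1)\<close> converge by continuity of the constraints along the
    pointwise convergent curves.\<close>
  have lim_max: "(\<lambda>n. max (\<rho> (r n) t) (E t)) \<longlonglongrightarrow> E t"
    if t: "t \<in> {0..T}" and ae: "(\<lambda>n. H (r n) t - h t) \<longlonglongrightarrow> 0" for t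
  proof -
    let ?v = "\<lambda>n. (C (r n) t - c t) / q (r n)"
    have X': "(\<lambda>n. X (r n) t) \<longlonglongrightarrow> x t"
      using LIMSEQ_subseq_LIMSEQ[OF lim[OF t] r(1)] by (simp add: o_def)
    have "(\<lambda>n. H (r n) t) \<longlonglongrightarrow> h t" using ae by (rule LIM_zero_cancel)
    then have "(\<lambda>n. max (?v n) (D t)) \<longlonglongrightarrow> D t"
      unfolding C_def c_def D_def H_def by (intro max_constraint_quotient_limit[OF C1 t X'])
    moreover have "(\<lambda>n. C (r n) t) \<longlonglongrightarrow> c t"
      unfolding C_def c_def
      by (rule tendsto_along_sequence[OF max_constraint_continuous[OF C1] X']) (use t in auto)
    then have "(\<lambda>n. C (r n) t powr (s - 1)) \<longlonglongrightarrow> c t powr (s - 1)"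
      using C0 s by (intro tendsto_powr' tendsto_const) auto
    ultimately have "(\<lambda>n. C (r n) t powr (s - 1) * max (?v n) (D t)) \<longlonglongrightarrow> E t"
      unfolding E_def by (intro tendsto_mult)
    then have "(\<lambda>n. max (C (r n) t powr (s - 1) * max (?v n) (D t)) (E t)) \<longlonglongrightarrow> max (E t) (E t)"
      by (intro tendsto_max tendsto_const)
    then have up: "(\<lambda>n. max (C (r n) t powr (s - 1) * max (?v n) (D t)) (E t)) \<longlonglongrightarrow> E t" by simp
    have le: "\<rho> n t \<le> C n t powr (s - 1) * max ((C n t - c t) / q n) (D t)" for n
    proof -
      have "\<rho> n t \<le> u n t" using K by (simp add: \<rho>_def)
      also have "\<dots> \<le> C n t powr (s - 1) * max ((C n t - c t) / q n) (D t)"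
        unfolding u_def by (intro mult_left_mono) auto
      finally show ?thesis .
    qed
    have "max (\<rho> (r n) t) (E t) \<le> max (C (r n) t powr (s - 1) * max (?v n) (D t)) (E t)" for n
      by (rule max.mono[OF le order_refl])
    then show ?thesis
      by (intro tendsto_sandwich[OF _ _ tendsto_const up] always_eventually allI) simp_all
  qed
  \<comment> \<open>Reverse Fatou in dominated form: the maximum is bounded below by
    \<open>E\<close> and above by the fixed majorant. The integral of \<open>\<rho>\<close> lies
    below that of the maximum, so an upper bound in the limit is all that is required.\<close>
  have "(\<lambda>n. LINT t|?M. max (\<rho> (r n) t) (E t)) \<longlonglongrightarrow> (LINT t|?M. E t)"
  proof (rule integral_dominated_convergence)
    show "integrable ?M (\<lambda>t. K * norm (h t) + \<bar>E t\<bar>)"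
      using Ei hi by (intro Bochner_Integration.integrable_add integrable_mult_right integrable_abs)
    show "AE t in ?M. (\<lambda>n. max (\<rho> (r n) t) (E t)) \<longlonglongrightarrow> E t"
      using r(2) AE_space by eventually_elim (use lim_max in \<open>simp add: space_restrict_space\<close>)
    show "AE t in ?M. norm (max (\<rho> (r n) t) (E t)) \<le> K * norm (h t) + \<bar>E t\<bar>" for n
    proof (rule AE_I2)
      fix t assume "t \<in> space ?M"
      then have t: "t \<in> {0..T}" by (simp add: space_restrict_space)
      have "norm (H (r n) t) \<le> norm (H (r n) t - h t) + norm (h t)"
        using norm_triangle_ineq[of "H (r n) t - h t" "h t"] by simp
      then have "K * norm (H (r n) t) \<le> K * (norm (H (r n) t - h t) + norm (h t))"
        using K by (rule mult_left_mono)
      then have "\<rho> (r n) t \<le> K * norm (h t)"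
        using u_le[OF t, of "r n"] by (simp add: \<rho>_def algebra_simps)
      moreover have "K * norm (h t) \<ge> 0" using K by simp
      ultimately show "norm (max (\<rho> (r n) t) (E t)) \<le> K * norm (h t) + \<bar>E t\<bar>" by simp
    qed
    show "E \<in> borel_measurable ?M" using Ei by (rule borel_measurable_integrable)
    show "(\<lambda>t. max (\<rho> (r n) t) (E t)) \<in> borel_measurable ?M" for n
      using Ei \<rho>i by (intro borel_measurable_max borel_measurable_integrable)
  qed
  moreover have "(\<lambda>n. K * (LINT t|?M. norm (H (r n) t - h t))) \<longlonglongrightarrow> 0"
    using tendsto_mult_right_zero[OF LIMSEQ_subseq_LIMSEQ[OF d0 r(1)], of K] by (simp add: o_def)
  ultimately have "(\<lambda>n. (LINT t|?M. max (\<rho> (r n) t) (E t)) + K * (LINT t|?M. norm (H (r n) t - h t)))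
      \<longlonglongrightarrow> (LINT t|?M. E t) + 0" by (rule tendsto_add)
  moreover have "(LINT t|?M. E t) + 0 < - (a / 2) * P powr (s - 1)"
    using LE mult_pos_pos[OF a Pp] by simp
  ultimately have "eventually (\<lambda>n. (LINT t|?M. max (\<rho> (r n) t) (E t))
      + K * (LINT t|?M. norm (H (r n) t - h t)) < - (a / 2) * P powr (s - 1)) sequentially"
    by (rule order_tendstoD(2))
  then obtain n where n: "n \<ge> m" "(LINT t|?M. max (\<rho> (r n) t) (E t))
      + K * (LINT t|?M. norm (H (r n) t - h t)) < - (a / 2) * P powr (s - 1)"
    unfolding eventually_sequentially by (meson max.cobounded1 max.cobounded2)
  define k where "k = r n"
  have "k \<ge> m" using n(1) seq_suble[OF r(1), of n] by (simp add: k_def)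
  have "(LINT t|?M. u k t) = (LINT t|?M. \<rho> k t + K * norm (H k t - h t))"
    by (simp add: \<rho>_def)
  also have "\<dots> = (LINT t|?M. \<rho> k t) + K * (LINT t|?M. norm (H k t - h t))"
    using \<rho>i[of k] di[of k] by simp
  also have "(LINT t|?M. \<rho> k t) \<le> (LINT t|?M. max (\<rho> k t) (E t))"
    by (intro integral_mono \<rho>i integrable_max Ei) auto
  finally have uk: "(LINT t|?M. u k t) < - (a / 2) * P powr (s - 1)"
    using n(2) by (simp add: k_def)
  have ci: "integrable ?M (\<lambda>t. c t powr s)" and Ci: "integrable ?M (\<lambda>t. C k t powr s)"
    using integrable_norm_powr[OF c, of s] integrable_norm_powr[OF C, of s k] s c0 C0 by simp_all
  have Ps: "P powr s = (LINT t|?M. c t powr s)" and Qs: "Q k powr s = (LINT t|?M. C k t powr s)"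
    using Lp_norm_finite_powr[OF p, of T c] Lp_norm_finite_powr[OF p, of T "C k"] c0 C0
    by (simp_all add: P_def Q_def penalty_term_def c_def C_def s_def)
  have Q0: "Q k \<ge> 0" "P \<ge> 0" using Lp_norm_finite_nonneg[OF p(2)] by (auto simp: Q_def P_def penalty_term_def)
  \<comment> \<open>This tangent is taken at the old norm \<open>P\<close> and turns a decrease of
    the power into one of the norm; the pointwise tangent below is taken at the new values. The
    common positive factor \<open>s * P powr (s - 1)\<close> finally cancels.\<close>
  have "s * P powr (s - 1) * (Q k - P) \<le> Q k powr s - P powr s"
    using powr_tangent_le[OF Q0 s] by (simp add: algebra_simps)
  also have "\<dots> = (LINT t|?M. C k t powr s - c t powr s)"
    using ci Ci by (simp add: Ps Qs)
  also have "\<dots> \<le> (LINT t|?M. s * q k * u k t)"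
  proof (intro integral_mono Bochner_Integration.integrable_diff ci Ci integrable_mult_right ui)
    show "C k t powr s - c t powr s \<le> s * q k * u k t" for t
      using powr_tangent_le[OF c0[of t] C0[of k t] s] q[of k] by (simp add: u_def mult.assoc)
  qed
  also have "\<dots> = s * q k * (LINT t|?M. u k t)" by simp
  also have "\<dots> \<le> s * q k * (- (a / 2) * P powr (s - 1))"
    using uk q[of k] s by (intro mult_left_mono) auto
  finally have "(s * P powr (s - 1)) * (Q k - P) \<le> (s * P powr (s - 1)) * (- (a / 2) * q k)"
    by (simp add: algebra_simps)
  moreover have "s * P powr (s - 1) > 0" using Pp s by simp
  ultimately have "Q k - P \<le> - (a / 2) * q k" by (simp only: mult_le_cancel_left_pos)
  then show ?thesis using \<open>k \<ge> m\<close> by (intro exI[of _ k]) (simp add: P_def Q_def)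
qed

text \<open>If the descent were too small at all late indices, maximisers along the sequence would
  accumulate at a time where a constraint attains the norm of \<open>x\<close>. There the assumed
  rate \<open>- a\<close> contradicts quotients that stay above \<open>- (a / 2)\<close>.\<close>

lemma slope_infinite_exponent:
  fixes g :: "nat \<Rightarrow> real^'d \<Rightarrow> real \<Rightarrow> real"
  assumes T: "T > 0"
    and C1: "\<And>j. j \<in> {1..l} \<Longrightarrow> C1_in_state T (g j)"
    and x: "continuous_on {0..T} x" and X: "\<And>n. continuous_on {0..T} (X n)"
    and q: "\<And>n. q n > 0" "q \<longlonglongrightarrow> 0" "\<And>n. q n = Lp_norm \<infinity> T (\<lambda>t. X n t - x t)"
    and h: "Lp_tendsto \<infinity> T (\<lambda>n t. (X n t - x t) /\<^sub>R q n) h"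
    and N: "penalty_term \<infinity> T l g x > 0" and a: "a > 0"
    and descent: "descent_condition \<infinity> T l g a x h"
  shows "\<exists>n\<ge>m. penalty_term \<infinity> T l g (X n) \<le> penalty_term \<infinity> T l g x - a / 2 * q n"
proof (rule ccontr)
  assume contr: "\<not> ?thesis"
  define P where "P = penalty_term \<infinity> T l g x"
  define Q where "Q = (\<lambda>n. penalty_term \<infinity> T l g (X n))"
  define w where "w = with_zero g"
  have neg: "Q n > P - a / 2 * q n" if "n \<ge> m" for n
    using contr that unfolding P_def Q_def by (meson not_le)
  have hc: "continuous_on {0..T} h"
    and desc: "\<And>t j. t \<in> {0..T} \<Longrightarrow> j \<in> {1..l} \<Longrightarrow> P = g j (x t) t \<Longrightarrow>
      gradient (\<lambda>y. g j y t) (x t) \<bullet> h t \<le> - a"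
    using descent by (auto simp: descent_condition_def P_def)
  have c_cont: "continuous_on {0..T} (\<lambda>t. max_constraint l g (y t) t)"
    if "continuous_on {0..T} y" for y :: "real \<Rightarrow> real^'d"
    by (intro continuous_on_along_curve[OF max_constraint_continuous[OF C1]] that)
  have cP: "max_constraint l g (x t) t \<le> P" if "t \<in> {0..T}" for t
    using Lp_norm_infinity_continuous[OF T c_cont[OF x]] that
    by (auto simp: P_def penalty_term_def max_constraint_nonneg)
  have "\<exists>t j. t \<in> {0..T} \<and> j \<in> {0..l} \<and> Q n = w j (X n t) t" for n
  proof -
    obtain t where t: "t \<in> {0..T}" "Q n = norm (max_constraint l g (X n t) t)"
      using Lp_norm_infinity_continuous[OF T c_cont[OF X[of n]]] by (auto simp: Q_def penalty_term_def)
    obtain j where "j \<in> {0..l}" "max_constraint l g (X n t) t = w j (X n t) t"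
      using active_set_nonempty[of l g "X n t" t] by (auto simp: active_set_def w_def)
    moreover have "Q n = max_constraint l g (X n t) t"
      using t(2) max_constraint_nonneg[of l g "X n t" t] by simp
    ultimately show ?thesis using t(1) by auto
  qed
  then obtain \<tau> j where \<tau>: "\<And>n. \<tau> n \<in> {0..T}" and j: "\<And>n. j n \<in> {0..l}"
    and Qw: "\<And>n. Q n = w (j n) (X n (\<tau> n)) (\<tau> n)" by metis
  \<comment> \<open>Finitely many constraints are available, so one of them attains the maximum
    infinitely often; only then is a convergent subsequence of times extracted.\<close>
  have "finite (j ` UNIV)" by (rule finite_subset[of _ "{0..l}"]) (use j in auto)
  then obtain n0 where inf: "infinite {n. j n = j n0}"
    using pigeonhole_infinite[of UNIV j] by auto
  obtain r1 :: "nat \<Rightarrow> nat" where "strict_mono r1" and "\<forall>n. r1 n \<in> {n. j n = j n0}"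
    using infinite_enumerate[OF inf] by (elim exE conjE)
  then have r1: "strict_mono r1" "j (r1 n) = j n0" for n by blast+
  have "seq_compact {0..T}" by (intro compact_imp_seq_compact compact_Icc)
  moreover have "\<forall>n. \<tau> (r1 n) \<in> {0..T}" using \<tau> by blast
  ultimately obtain t r2 where t: "t \<in> {0..T}"
    and r2: "strict_mono r2" "((\<lambda>n. \<tau> (r1 n)) \<circ> r2) \<longlonglongrightarrow> t"
    by (rule seq_compactE)
  define r where "r = r1 \<circ> r2"
  define i where "i = j n0"
  have r: "strict_mono r" using r1(1) r2(1) by (simp add: r_def strict_mono_o)
  have \<tau>r: "(\<lambda>n. \<tau> (r n)) \<longlonglongrightarrow> t" using r2(2) by (simp add: r_def o_def)
  have i: "i \<in> {0..l}" using j by (simp add: i_def)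
  have Qr: "Q (r n) = w i (X (r n) (\<tau> (r n))) (\<tau> (r n))" for n
    using Qw[of "r n"] r1(2)[of "r2 n"] by (simp add: r_def i_def)
  have w1: "C1_in_state T (w i)"
    unfolding w_def using i by (rule C1_in_state_with_zero[rotated]) (rule C1)
  have qr: "(\<lambda>n. q (r n)) \<longlonglongrightarrow> 0" using LIMSEQ_subseq_LIMSEQ[OF q(2) r] by (simp add: o_def)
  have x\<tau>: "(\<lambda>n. x (\<tau> (r n))) \<longlonglongrightarrow> x t" and h\<tau>: "(\<lambda>n. h (\<tau> (r n))) \<longlonglongrightarrow> h t"
    by (rule continuous_on_tendsto_compose[OF x \<tau>r t] continuous_on_tendsto_compose[OF hc \<tau>r t];
        use \<tau> in simp)+
  have Xx: "norm (X n s - x s) \<le> q n" if "s \<in> {0..T}" for n s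
    unfolding q(3) by (rule norm_le_Lp_norm_infinity[OF T _ that]) (intro continuous_intros X x)
  have "(\<lambda>n. X (r n) (\<tau> (r n)) - x (\<tau> (r n))) \<longlonglongrightarrow> 0"
    by (rule Lim_null_comparison[OF always_eventually[OF allI[OF Xx[OF \<tau>]]] qr])
  from tendsto_add[OF this x\<tau>] have X\<tau>: "(\<lambda>n. X (r n) (\<tau> (r n))) \<longlonglongrightarrow> x t" by simp
  define H where "H = (\<lambda>n t. (X n t - x t) /\<^sub>R q n)"
  have Hh: "(\<lambda>n. Lp_norm \<infinity> T (\<lambda>t. H n t - h t)) \<longlonglongrightarrow> 0"
    using h by (simp add: Lp_tendsto_def H_def)
  \<comment> \<open>For the continuous representative the essential supremum bounds
    \<open>H n s - h s\<close> at every time, hence also at the moving times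
    \<open>\<tau> (r n)\<close>.\<close>
  have Hc: "continuous_on {0..T} (\<lambda>t. H n t - h t)" for n
    unfolding H_def by (intro continuous_intros X x hc)
  have H_le: "norm (H n s - h s) \<le> Lp_norm \<infinity> T (\<lambda>t. H n t - h t)" if "s \<in> {0..T}" for n s
    by (rule norm_le_Lp_norm_infinity[OF T Hc that])
  have Hh_r: "(\<lambda>n. Lp_norm \<infinity> T (\<lambda>t. H (r n) t - h t)) \<longlonglongrightarrow> 0"
    using LIMSEQ_subseq_LIMSEQ[OF Hh r] by (simp only: o_def)
  have "(\<lambda>n. H (r n) (\<tau> (r n)) - h (\<tau> (r n))) \<longlonglongrightarrow> 0"
    by (rule Lim_null_comparison[OF always_eventually[OF allI[OF H_le[OF \<tau>]]] Hh_r])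
  from tendsto_add[OF this h\<tau>]
  have H\<tau>: "(\<lambda>n. (X (r n) (\<tau> (r n)) - x (\<tau> (r n))) /\<^sub>R q (r n)) \<longlonglongrightarrow> h t"
    by (simp add: H_def)
  have Qlim: "(\<lambda>n. Q (r n)) \<longlonglongrightarrow> w i (x t) t"
    unfolding Qr by (rule tendsto_along_sequence[OF C1_in_state_D(1)[OF w1] X\<tau> \<tau>r \<tau> t])
  have rm: "r n \<ge> m" if "n \<ge> m" for n using seq_suble[OF r, of n] that by simp
  \<comment> \<open>The negated claim keeps \<open>Q (r n)\<close> above a sequence tending to
    \<open>P\<close>, so the limiting value is at least \<open>P\<close> and therefore equal to it.
    Positivity of \<open>P\<close> rules out the index 0, and the pointwise descent condition
    applies at \<open>t\<close>.\<close>
  have "(\<lambda>n. P - a / 2 * q (r n)) \<longlonglongrightarrow> P - a / 2 * 0" by (intro tendsto_intros qr)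
  then have "P - a / 2 * 0 \<le> w i (x t) t"
    by (rule LIMSEQ_le[OF _ Qlim]) (use neg rm in \<open>auto intro!: exI[of _ m] less_imp_le\<close>)
  moreover have "w i (x t) t \<le> P"
    using with_zero_le_max_constraint[OF i, of g "x t" t] cP[OF t] by (simp add: w_def)
  ultimately have wP: "w i (x t) t = P" by simp
  then have "i \<noteq> 0" using N by (cases "i = 0") (auto simp: w_def with_zero_def P_def)
  then have wg: "w i = g i" by (simp add: w_def with_zero_def fun_eq_iff)
  have "gradient (\<lambda>y. w i y t) (x t) \<bullet> h t \<le> - a"
    using desc[OF t, of i] wP i \<open>i \<noteq> 0\<close> by (simp add: wg)
  moreover have "(\<lambda>n. (w i (X (r n) (\<tau> (r n))) (\<tau> (r n)) - w i (x (\<tau> (r n))) (\<tau> (r n))) / q (r n))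
      \<longlonglongrightarrow> gradient (\<lambda>y. w i y t) (x t) \<bullet> h t"
    by (rule C1_in_state_quotient_tendsto[OF w1 x\<tau> X\<tau> \<tau>r \<tau> t H\<tau>])
  \<comment> \<open>The value along \<open>X\<close> is \<open>Q (r n)\<close>, which exceeds
    \<open>P - a / 2 * q (r n)\<close>, while the value along \<open>x\<close> is at most
    \<open>P\<close>.\<close>
  moreover have "- (a / 2) \<le> (w i (X (r n) (\<tau> (r n))) (\<tau> (r n)) - w i (x (\<tau> (r n))) (\<tau> (r n))) / q (r n)"
    if "n \<ge> m" for n
  proof -
    have "w i (x (\<tau> (r n))) (\<tau> (r n)) \<le> P"
      using with_zero_le_max_constraint[OF i, of g "x (\<tau> (r n))" "\<tau> (r n)"] cP[OF \<tau>, of "r n"]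
      by (simp add: w_def)
    then show ?thesis using neg[OF rm[OF that]] q(1)[of "r n"] by (simp add: Qr field_simps)
  qed
  ultimately have "- (a / 2) \<le> - a"
    by (meson LIMSEQ_le_const order_trans)
  then show False using a by simp
qed

section \<open>Compact sets of trajectories\<close>

text \<open>The second fact rests on extensionality outside \<open>{0..T}\<close>; it is what makes
  \<open>dist_X\<close> separate points.\<close>

lemma mspace_C_spaceD:
  fixes x y :: "real \<Rightarrow> 'a::euclidean_space"
  assumes "x \<in> mspace (C_space T)"
  shows "continuous_on {0..T} x"
    and "y \<in> mspace (C_space T) \<Longrightarrow> (\<And>t. t \<in> {0..T} \<Longrightarrow> x t = y t) \<Longrightarrow> x = y"
  using assms by (auto simp: C_space_def intro: extensionalityI)

lemma mdist_C_space_imp_dist_le: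
  fixes x y :: "real \<Rightarrow> 'a::euclidean_space"
  assumes "x \<in> mspace (C_space T)" "y \<in> mspace (C_space T)" "mdist (C_space T) x y \<le> e" "t \<in> {0..T}"
  shows "dist (x t) (y t) \<le> e"
  using mdist_cfunspace_imp_mdist_le[of x "top_of_set {0..T}" euclidean_metric y e t] assms
  by (simp add: C_space_def)

text \<open>The conclusion is unfolded to uniform closeness on \<open>{0..T}\<close>, from which
  both pointwise convergence and convergence in \<open>dist_X\<close> are read off.\<close>

lemma compactin_C_space_subsequence:
  fixes s :: "nat \<Rightarrow> real \<Rightarrow> 'a::euclidean_space"
  assumes K: "compactin (mtopology_of (C_space T)) K" and s: "\<And>n. s n \<in> K"
  shows "\<exists>x\<in>K. \<exists>r. strict_mono r \<and>
    (\<forall>e>0. eventually (\<lambda>n. \<forall>t\<in>{0..T}. dist (s (r n) t) (x t) \<le> e) sequentially)"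
proof -
  interpret C: Metric_space "mspace (C_space T :: (real \<Rightarrow> 'a) metric)" "mdist (C_space T)"
    by (rule Metric_space_mspace_mdist)
  have "compactin C.mtopology K" using K by (simp add: mtopology_of_def)
  then obtain x r where x: "x \<in> K" and r: "strict_mono (r :: nat \<Rightarrow> nat)"
    and lim: "limitin C.mtopology (s \<circ> r) x sequentially"
    using s unfolding C.compactin_sequentially by (metis image_subsetI)
  have "eventually (\<lambda>n. \<forall>t\<in>{0..T}. dist (s (r n) t) (x t) \<le> e) sequentially" if "e > 0" for e
  proof -
    obtain N where xm: "x \<in> mspace (C_space T)"
      and N: "\<forall>n\<ge>N. (s \<circ> r) n \<in> mspace (C_space T) \<and> mdist (C_space T) ((s \<circ> r) n) x < e"
      using lim \<open>e > 0\<close> unfolding C.limit_metric_sequentially by blast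
    have "dist (s (r n) t) (x t) \<le> e" if "n \<ge> N" "t \<in> {0..T}" for n t
      using N that xm by (intro mdist_C_space_imp_dist_le[where T = T]) (auto intro: less_imp_le)
    then show ?thesis unfolding eventually_sequentially by blast
  qed
  then show ?thesis using x r by blast
qed

text \<open>A compact set lies in a ball of the uniform metric, and its centre is itself bounded,
  being continuous on a compact interval. The common bound fixes the ball on which all Lipschitz
  constants are chosen.\<close>

lemma compactin_C_space_bounded:
  fixes K :: "(real \<Rightarrow> 'a::euclidean_space) set"
  assumes K: "compactin (mtopology_of (C_space T)) K"
  shows "\<exists>R. \<forall>x\<in>K. \<forall>t\<in>{0..T}. norm (x t) \<le> R"
proof -
  interpret C: Metric_space "mspace (C_space T :: (real \<Rightarrow> 'a) metric)" "mdist (C_space T)"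
    by (rule Metric_space_mspace_mdist)
  have "C.mbounded K" using K by (intro C.compactin_imp_mbounded) (simp add: mtopology_of_def)
  then obtain y B where yB: "K \<subseteq> C.mcball y B" unfolding C.mbounded_def by blast
  show ?thesis
  proof (cases "K = {}")
    case False
    then have y: "y \<in> mspace (C_space T)" using yB by auto
    have "bounded (y ` {0..T})"
      by (intro compact_imp_bounded compact_continuous_image mspace_C_spaceD(1)[OF y] compact_Icc)
    then obtain R where "\<forall>t\<in>{0..T}. norm (y t) \<le> R" by (auto simp: bounded_iff)
    then have R: "\<And>t. t \<in> {0..T} \<Longrightarrow> norm (y t) \<le> R" by simp
    have "norm (x t) \<le> R + B" if "x \<in> K" "t \<in> {0..T}" for x t
    proof -
      have "dist (y t) (x t) \<le> B"
        using yB that y by (intro mdist_C_space_imp_dist_le[where T = T]) auto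
      then show ?thesis
        using R[OF that(2)] norm_triangle_ineq[of "y t" "x t - y t"] by (simp add: dist_norm norm_minus_commute)
    qed
    then show ?thesis by blast
  qed auto
qed

text \<open>The parametric notion \<open>local_lipschitz\<close> is used with a dummy parameter
  ranging over a single point.\<close>

lemma locally_Lipschitz_imp_Lipschitz_on_compact:
  fixes F :: "'a::metric_space \<Rightarrow> 'b::metric_space"
  assumes "locally_Lipschitz F" "compact S"
  obtains L where "L-lipschitz_on S F"
proof -
  have "local_lipschitz {0::real} S (\<lambda>_. F)"
    unfolding local_lipschitz_def
  proof (intro ballI)
    fix x assume "x \<in> S"
    obtain r L where r: "r > 0" "L-lipschitz_on (ball x r) F"
      using assms(1) unfolding locally_Lipschitz_def by blast
    have "L-lipschitz_on (cball x (r / 2) \<inter> S) F"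
      by (rule lipschitz_on_subset[OF r(2)]) (use r(1) in auto)
    then show "\<exists>u>0. \<exists>L. \<forall>s\<in>cball t u \<inter> {0::real}. L-lipschitz_on (cball x u \<inter> S) F" for t
      using r(1) by (intro exI[of _ "r / 2"]) auto
  qed
  then obtain L where "\<And>t. t \<in> {0::real} \<Longrightarrow> L-lipschitz_on S F"
    by (rule local_lipschitz_compact_implies_lipschitz[OF _ assms(2)]) auto
  then show ?thesis using that by simp
qed

lemma Lp_norm_minus_commute: "Lp_norm p T (\<lambda>t. x t - y t) = Lp_norm p T (\<lambda>t. y t - x t)"
  by (simp add: Lp_norm_def norm_minus_commute)

lemma Lp_tendsto_subseq:
  assumes "Lp_tendsto p T y h" "strict_mono r"
  shows "Lp_tendsto p T (\<lambda>n. y (r n)) h"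
  using assms LIMSEQ_subseq_LIMSEQ[of "\<lambda>n. Lp_norm p T (\<lambda>t. y n t - h t)" 0 r]
  by (auto simp: Lp_tendsto_def o_def)

section \<open>Lipschitz continuity of the penalty term and of the cost\<close>

lemma penalty_term_Lipschitz:
  fixes g :: "nat \<Rightarrow> real^'d \<Rightarrow> real \<Rightarrow> real"
  assumes T: "T > 0" and p: "1 < p"
    and C1: "\<And>j. j \<in> {1..l} \<Longrightarrow> C1_in_state T (g j)"
  shows "\<exists>M\<ge>0. \<forall>x y. continuous_on {0..T} x \<longrightarrow> continuous_on {0..T} y \<longrightarrow>
    (\<forall>t\<in>{0..T}. norm (x t) \<le> R \<and> norm (y t) \<le> R) \<longrightarrow>
    penalty_term p T l g x - penalty_term p T l g y \<le> M * Lp_norm p T (\<lambda>t. x t - y t)"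
proof -
  have "\<exists>M\<ge>0. \<forall>x\<in>cball 0 R. \<forall>y\<in>cball 0 R. \<forall>t\<in>{0..T}.
      \<bar>max_constraint l g y t - max_constraint l g x t\<bar> \<le> M * norm (y - x)"
    by (rule constraints_Lipschitz) (rule C1)
  then obtain M where M0: "M \<ge> 0" and "\<forall>x\<in>cball 0 R. \<forall>y\<in>cball 0 R. \<forall>t\<in>{0..T}.
      \<bar>max_constraint l g y t - max_constraint l g x t\<bar> \<le> M * norm (y - x)" by (elim exE conjE)
  then have M: "\<And>x y t. norm x \<le> R \<Longrightarrow> norm y \<le> R \<Longrightarrow> t \<in> {0..T} \<Longrightarrow>
      \<bar>max_constraint l g y t - max_constraint l g x t\<bar> \<le> M * norm (y - x)" by simp
  have "penalty_term p T l g x - penalty_term p T l g y \<le> M * Lp_norm p T (\<lambda>t. x t - y t)"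
    if x: "continuous_on {0..T} x" and y: "continuous_on {0..T} y"
      and R: "\<forall>t\<in>{0..T}. norm (x t) \<le> R \<and> norm (y t) \<le> R" for x y
  proof -
    define u v where "u = (\<lambda>t. max_constraint l g (x t) t)" and "v = (\<lambda>t. max_constraint l g (y t) t)"
    have u: "continuous_on {0..T} u" and v: "continuous_on {0..T} v"
      unfolding u_def v_def
      by (intro continuous_on_along_curve[OF max_constraint_continuous[OF C1]] x y; assumption)+
    have "Lp_norm p T (\<lambda>t. v t + (u t - v t)) \<le> Lp_norm p T v + Lp_norm p T (\<lambda>t. u t - v t)"
      by (intro Lp_norm_triangle T p v continuous_intros u)
    moreover have "Lp_norm p T (\<lambda>t. u t - v t) \<le> M * Lp_norm p T (\<lambda>t. x t - y t)"
      using M R by (intro Lp_norm_mono T p continuous_intros u v x y M0) (simp add: u_def v_def)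
    ultimately show ?thesis by (simp add: penalty_term_def u_def v_def)
  qed
  then show ?thesis using M0 by blast
qed

text \<open>The endpoint summand of \<open>dist_X\<close> controls \<open>\<zeta>\<close>, and the
  integral part is controlled by the norm through the embedding into
  \<open>L\<^sup>1\<close>.\<close>

lemma cost_Lipschitz:
  fixes \<theta> :: "real^'d \<Rightarrow> real \<Rightarrow> real"
  assumes T: "T > 0" and p: "1 < p"
    and \<zeta>: "locally_Lipschitz \<zeta>" and \<theta>: "C1_in_state T \<theta>"
  shows "\<exists>L. \<forall>x y. continuous_on {0..T} x \<longrightarrow> continuous_on {0..T} y \<longrightarrow>
    (\<forall>t\<in>{0..T}. norm (x t) \<le> R \<and> norm (y t) \<le> R) \<longrightarrow>
    cost T \<theta> \<zeta> x - cost T \<theta> \<zeta> y \<le> L * dist_X p T x y"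
proof -
  obtain L where L: "L-lipschitz_on (cball 0 R) \<zeta>"
    by (rule locally_Lipschitz_imp_Lipschitz_on_compact[OF \<zeta> compact_cball])
  have L0: "L \<ge> 0" using L by (rule lipschitz_on_nonneg)
  obtain M where M0: "M \<ge> 0" and M: "\<And>x y t. norm x \<le> R \<Longrightarrow> norm y \<le> R \<Longrightarrow> t \<in> {0..T} \<Longrightarrow>
      \<bar>\<theta> y t - \<theta> x t\<bar> \<le> M * norm (y - x)"
    using C1_in_state_Lipschitz[OF \<theta>, of R] by auto
  have "cost T \<theta> \<zeta> x - cost T \<theta> \<zeta> y \<le> (M * (T + 1) + L) * dist_X p T x y"
    if x: "continuous_on {0..T} x" and y: "continuous_on {0..T} y"
      and R: "\<forall>t\<in>{0..T}. norm (x t) \<le> R \<and> norm (y t) \<le> R" for x y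
  proof -
    let ?M = "lebesgue_on {0..T}"
    have xy: "continuous_on {0..T} (\<lambda>t. x t - y t)" by (intro continuous_intros x y)
    define N where "N = Lp_norm p T (\<lambda>t. x t - y t)"
    have N0: "N \<ge> 0" unfolding N_def by (rule Lp_norm_nonneg[OF T xy])
    have \<theta>c: "continuous_on {0..T} (\<lambda>t. \<theta> (z t) t)" if "continuous_on {0..T} z" for z
      by (rule continuous_on_along_curve[OF C1_in_state_D(1)[OF \<theta>] that])
    have I: "cost T \<theta> \<zeta> z = (LINT t|?M. \<theta> (z t) t) + \<zeta> (z T)" for z
      by (simp add: cost_def integral_restrict_space set_lebesgue_integral_def)
    have "(LINT t|?M. \<theta> (x t) t) - (LINT t|?M. \<theta> (y t) t) = (LINT t|?M. \<theta> (x t) t - \<theta> (y t) t)"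
      by (intro Bochner_Integration.integral_diff[symmetric] continuous_imp_integrable_real \<theta>c x y)
    also have "\<dots> \<le> (LINT t|?M. M * norm (x t - y t))"
    proof (intro integral_mono continuous_imp_integrable_real continuous_intros \<theta>c x y)
      fix t assume "t \<in> space ?M"
      then have "t \<in> {0..T}" by (simp add: space_restrict_space)
      then show "\<theta> (x t) t - \<theta> (y t) t \<le> M * norm (x t - y t)"
        using M[of "y t" "x t" t] R by (simp add: abs_le_iff)
    qed
    also have "\<dots> = M * (LINT t|?M. norm (x t - y t))" by simp
    also have "\<dots> \<le> M * ((T + 1) * N)"
      unfolding N_def by (intro mult_left_mono M0 LINT_norm_le_Lp_norm_continuous T p xy)
    finally have 1: "(LINT t|?M. \<theta> (x t) t) - (LINT t|?M. \<theta> (y t) t) \<le> M * (T + 1) * N"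
      by (simp add: mult.assoc)
    have "x T \<in> cball 0 R" "y T \<in> cball 0 R" using R T by auto
    then have "\<zeta> (x T) - \<zeta> (y T) \<le> L * norm (x T - y T)"
      using lipschitz_onD[OF L, of "x T" "y T"] by (simp add: dist_real_def dist_norm abs_le_iff)
    moreover have "M * (T + 1) * norm (x T - y T) \<ge> 0" "L * N \<ge> 0" using M0 T L0 N0 by simp_all
    ultimately show ?thesis
      using 1 by (simp add: I dist_X_def N_def[symmetric] algebra_simps)
  qed
  then show ?thesis by blast
qed

text \<open>The constraint curve is continuous, so a vanishing norm yields the constraints at every
  time rather than almost every time.\<close>

lemma feasible_eq_penalty_zero:
  assumes T: "T > 0" and p: "1 < p" and C1: "\<And>j. j \<in> {1..l} \<Longrightarrow> C1_in_state T (g j)"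
  shows "feasible T x0 f U S l g = {x \<in> admissible T x0 f U S. penalty_term p T l g x = 0}"
proof -
  have "(\<forall>t\<in>{0..T}. \<forall>j\<in>{1..l}. g j (x t) t \<le> 0) \<longleftrightarrow> penalty_term p T l g x = 0"
    if "x \<in> admissible T x0 f U S" for x
  proof -
    have "continuous_on {0..T} x"
      using that by (intro mspace_C_spaceD(1)) (simp add: admissible_def trajectories_def)
    then have c: "continuous_on {0..T} (\<lambda>t. max_constraint l g (x t) t)"
      by (intro continuous_on_along_curve[OF max_constraint_continuous[OF C1]])
    have "max_constraint l g (x t) t = 0 \<longleftrightarrow> (\<forall>j\<in>{1..l}. g j (x t) t \<le> 0)" for t
    proof -
      have "max_constraint l g (x t) t \<le> 0 \<longleftrightarrow> (\<forall>j\<in>{1..l}. g j (x t) t \<le> 0)"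
        unfolding max_constraint_def by (subst Max_le_iff) auto
      then show ?thesis using max_constraint_nonneg[of l g "x t" t] by linarith
    qed
    then show ?thesis
      unfolding penalty_term_def Lp_norm_eq_0_iff[OF T p c] by simp
  qed
  then show ?thesis by (auto simp: feasible_def)
qed

section \<open>The abstract criterion applied to the control problem\<close>

theorem theorem18:
  fixes T :: real and p q :: ereal and l :: nat
    and x0 :: "real^'d" and S\<^sub>T :: "(real^'d) set"
    and U :: "(real \<Rightarrow> real^'m) set"
    and \<theta> :: "real^'d \<Rightarrow> real \<Rightarrow> real" and \<zeta> :: "real^'d \<Rightarrow> real"
    and f :: "real^'d \<Rightarrow> real^'m \<Rightarrow> real \<Rightarrow> real^'d"
    and g :: "nat \<Rightarrow> real^'d \<Rightarrow> real \<Rightarrow> real"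
  assumes "T > 0" and "1 \<le> q" and "1 < p"
    and "closed S\<^sub>T" and "Lp_closed q T U"
    and "locally_Lipschitz \<zeta>" and "C1_in_state T \<theta>"
    and "\<And>j. j \<in> {1..l} \<Longrightarrow> C1_in_state T (g j)"
    and "compactin (mtopology_of (C_space T)) (trajectories T x0 f U)"
    and "feasible T x0 f U S\<^sub>T l g \<noteq> {}"
    and "\<exists>a>0. \<exists>\<eta>>0. \<forall>x \<in> admissible T x0 f U S\<^sub>T - feasible T x0 f U S\<^sub>T l g.
           \<exists>xs h. (\<forall>n. xs n \<in> admissible T x0 f U S\<^sub>T \<and> xs n \<noteq> x)
             \<and> (\<lambda>n. dist_X p T (xs n) x) \<longlonglongrightarrow> 0
             \<and> (\<forall>n. norm (xs n T - x T) \<le> \<eta> * Lp_norm p T (\<lambda>t. xs n t - x t))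
             \<and> Lp_tendsto p T
                 (\<lambda>n t. (xs n t - x t) /\<^sub>R Lp_norm p T (\<lambda>s. xs n s - x s)) h
             \<and> descent_condition p T l g a x h"
  shows "completely_exact (dist_X p T) (admissible T x0 f U S\<^sub>T) (feasible T x0 f U S\<^sub>T l g)
           (cost T \<theta> \<zeta>) (penalty_fun p T \<theta> \<zeta> l g)"
proof -
  note T = assms(1) and p = assms(3) and C1 = assms(8)
  define A where "A = admissible T x0 f U S\<^sub>T"
  define \<phi> where "\<phi> = penalty_term p T l g"
  let ?d = "dist_X p T"
  let ?N = "\<lambda>x y. Lp_norm p T (\<lambda>t. x t - y t)"
  have traj: "x \<in> trajectories T x0 f U" if "x \<in> A" for x using that by (simp add: A_def admissible_def)
  have Am: "x \<in> mspace (C_space T)" if "x \<in> A" for x using traj[OF that] by (simp add: trajectories_def)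
  have cont: "continuous_on {0..T} x" if "x \<in> A" for x by (rule mspace_C_spaceD(1)[OF Am[OF that]])
  have diff: "continuous_on {0..T} (\<lambda>t. x t - y t)" if "x \<in> A" "y \<in> A" for x y
    by (intro continuous_intros cont that)
  obtain R where "\<forall>x\<in>trajectories T x0 f U. \<forall>t\<in>{0..T}. norm (x t) \<le> R"
    using compactin_C_space_bounded[OF assms(9)] by (elim exE)
  then have R: "norm (x t) \<le> R" if "x \<in> A" "t \<in> {0..T}" for x t using that traj by simp
  have N0: "?N x y \<ge> 0" if "x \<in> A" "y \<in> A" for x y by (rule Lp_norm_nonneg[OF T diff[OF that]])
  have N_le: "?N x y \<le> ?d x y" for x y by (simp add: dist_X_def)
  have N_pos: "?N x y > 0" if "x \<in> A" "y \<in> A" "x \<noteq> y" for x y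
  proof -
    have "?N x y \<noteq> 0"
    proof
      assume "?N x y = 0"
      then have "\<forall>t\<in>{0..T}. x t - y t = 0" using Lp_norm_eq_0_iff[OF T p diff[OF that(1,2)]] by simp
      then have "x = y" by (intro mspace_C_spaceD(2)[OF Am[OF that(1)] Am[OF that(2)]]) simp
      then show False using that(3) by simp
    qed
    then show ?thesis using N0[OF that(1,2)] by simp
  qed
  have sym: "?d x y = ?d y x" for x y
    unfolding dist_X_def by (subst Lp_norm_minus_commute, subst norm_minus_commute) (rule refl)
  have tri: "?d x z \<le> ?d x y + ?d y z" if "x \<in> A" "y \<in> A" "z \<in> A" for x y z
  proof -
    have "Lp_norm p T (\<lambda>t. (x t - y t) + (y t - z t)) \<le> ?N x y + ?N y z"
      by (intro Lp_norm_triangle T p diff that)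
    moreover have "norm ((x T - y T) + (y T - z T)) \<le> norm (x T - y T) + norm (y T - z T)"
      by (rule norm_triangle_ineq)
    ultimately show ?thesis by (simp add: dist_X_def)
  qed
  have pos: "?d x y > 0" if "x \<in> A" "y \<in> A" "x \<noteq> y" for x y
    using N_pos[OF that] N_le[of x y] by simp
  have zero: "?d x x = 0" if "x \<in> A" for x
    using Lp_norm_eq_0_iff[OF T p diff[OF that that]] by (simp add: dist_X_def)
  \<comment> \<open>Pointwise convergence is kept alongside convergence in \<open>dist_X\<close>,
    since the slope argument for finite \<open>p\<close> needs it.\<close>
  have comp: "\<exists>x\<in>A. \<exists>r. strict_mono r \<and> (\<lambda>n. ?d (s (r n)) x) \<longlonglongrightarrow> 0
      \<and> (\<forall>t\<in>{0..T}. (\<lambda>n. s (r n) t) \<longlonglongrightarrow> x t)"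
    if s: "\<And>n. s n \<in> A" for s :: "nat \<Rightarrow> real \<Rightarrow> real^'d"
  proof -
    have "\<exists>x\<in>trajectories T x0 f U. \<exists>r. strict_mono r \<and>
        (\<forall>e>0. eventually (\<lambda>n. \<forall>t\<in>{0..T}. dist (s (r n) t) (x t) \<le> e) sequentially)"
      by (rule compactin_C_space_subsequence[OF assms(9)]) (rule traj[OF s])
    then obtain x r where x: "x \<in> trajectories T x0 f U" and r: "strict_mono (r :: nat \<Rightarrow> nat)"
      and "\<forall>e>0. eventually (\<lambda>n. \<forall>t\<in>{0..T}. dist (s (r n) t) (x t) \<le> e) sequentially"
      by (elim bexE exE conjE)
    then have unif: "eventually (\<lambda>n. \<forall>t\<in>{0..T}. dist (s (r n) t) (x t) \<le> e) sequentially"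
      if "e > 0" for e using that by blast
    have pw: "(\<lambda>n. s (r n) t) \<longlonglongrightarrow> x t" if "t \<in> {0..T}" for t
    proof (rule tendstoI)
      fix e :: real assume "e > 0"
      then have "eventually (\<lambda>n. \<forall>t\<in>{0..T}. dist (s (r n) t) (x t) \<le> e / 2) sequentially"
        by (intro unif) simp
      then show "eventually (\<lambda>n. dist (s (r n) t) (x t) < e) sequentially"
        by (rule eventually_mono) (use that \<open>e > 0\<close> in fastforce)
    qed
    have "x T \<in> S\<^sub>T"
      by (rule closed_sequentially[OF assms(4) _ pw]) (use s T in \<open>auto simp: A_def admissible_def\<close>)
    then have xA: "x \<in> A" using x by (simp add: A_def admissible_def)
    \<comment> \<open>Uniform distance \<open>e'\<close> gives norm distance at most
      \<open>e' * K\<close>; dividing \<open>e\<close> by \<open>K + 1\<close> below keeps the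
      estimate strict.\<close>
    define K where "K = Lp_norm p T (\<lambda>t. 1 :: real)"
    have K: "K \<ge> 0" unfolding K_def by (rule Lp_norm_nonneg[OF T]) simp
    have "(\<lambda>n. ?N (s (r n)) x) \<longlonglongrightarrow> 0"
    proof (rule tendstoI)
      fix e :: real assume e: "e > 0"
      define e' where "e' = e / (K + 1)"
      have e': "e' > 0" "e' * K < e" using e K by (auto simp: e'_def field_simps)
      from unif[OF e'(1)]
      show "eventually (\<lambda>n. dist (?N (s (r n)) x) 0 < e) sequentially"
      proof (rule eventually_mono)
        fix n assume le: "\<forall>t\<in>{0..T}. dist (s (r n) t) (x t) \<le> e'"
        have "?N (s (r n)) x \<le> e' * K"
          unfolding K_def using le e'(1)
          by (intro Lp_norm_mono T p diff s xA continuous_intros) (auto simp: dist_norm)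
        then show "dist (?N (s (r n)) x) 0 < e" using e'(2) N0[OF s xA, of "r n"] by simp
      qed
    qed
    moreover have "(\<lambda>n. norm (s (r n) T - x T)) \<longlonglongrightarrow> 0"
      using pw[of T] T by (intro tendsto_norm_zero LIM_zero) simp
    ultimately have "(\<lambda>n. ?d (s (r n)) x) \<longlonglongrightarrow> 0 + 0" unfolding dist_X_def by (rule tendsto_add)
    then show ?thesis using xA r pw by (intro bexI[of _ x] exI[of _ r]) simp_all
  qed
  have "\<exists>M\<ge>0. \<forall>x y. continuous_on {0..T} x \<longrightarrow> continuous_on {0..T} y \<longrightarrow>
    (\<forall>t\<in>{0..T}. norm (x t) \<le> R \<and> norm (y t) \<le> R) \<longrightarrow>
    penalty_term p T l g x - penalty_term p T l g y \<le> M * Lp_norm p T (\<lambda>t. x t - y t)"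
    by (rule penalty_term_Lipschitz[OF T p]) (rule C1)
  then obtain M where M0: "M \<ge> 0" and M: "\<And>x y. continuous_on {0..T} x \<Longrightarrow> continuous_on {0..T} y \<Longrightarrow>
    (\<forall>t\<in>{0..T}. norm (x t) \<le> R \<and> norm (y t) \<le> R) \<Longrightarrow>
    penalty_term p T l g x - penalty_term p T l g y \<le> M * Lp_norm p T (\<lambda>t. x t - y t)" by auto
  have lip: "\<phi> x - \<phi> y \<le> M * ?d x y" if "x \<in> A" "y \<in> A" for x y
  proof -
    have "\<phi> x - \<phi> y \<le> M * ?N x y"
      unfolding \<phi>_def using that R by (intro M cont) auto
    also have "\<dots> \<le> M * ?d x y" by (intro mult_left_mono N_le M0)
    finally show ?thesis .
  qed
  obtain L where L: "\<And>x y. continuous_on {0..T} x \<Longrightarrow> continuous_on {0..T} y \<Longrightarrow>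
    (\<forall>t\<in>{0..T}. norm (x t) \<le> R \<and> norm (y t) \<le> R) \<Longrightarrow>
    cost T \<theta> \<zeta> x - cost T \<theta> \<zeta> y \<le> L * ?d x y"
    using cost_Lipschitz[OF T p assms(6,7), of R] by auto
  have lipI: "cost T \<theta> \<zeta> x - cost T \<theta> \<zeta> y \<le> L * ?d x y" if "x \<in> A" "y \<in> A" for x y
    using that R by (intro L cont) auto
  have nonneg: "\<phi> x \<ge> 0" if "x \<in> A" for x
    unfolding \<phi>_def penalty_term_def
    by (intro Lp_norm_nonneg T continuous_on_along_curve[OF max_constraint_continuous[OF C1]] cont that)
  have feas: "feasible T x0 f U S\<^sub>T l g = {x \<in> A. \<phi> x = 0}"
    unfolding A_def \<phi>_def by (rule feasible_eq_penalty_zero[OF T p C1])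
  obtain a \<eta> where a: "a > 0" and \<eta>: "\<eta> > 0" and ex: "\<And>x. x \<in> A \<Longrightarrow> \<phi> x \<noteq> 0 \<Longrightarrow>
           \<exists>xs h. (\<forall>n. xs n \<in> A \<and> xs n \<noteq> x) \<and> (\<lambda>n. ?d (xs n) x) \<longlonglongrightarrow> 0
             \<and> (\<forall>n. norm (xs n T - x T) \<le> \<eta> * ?N (xs n) x)
             \<and> Lp_tendsto p T (\<lambda>n t. (xs n t - x t) /\<^sub>R ?N (xs n) x) h
             \<and> descent_condition p T l g a x h"
    using assms(11) unfolding A_def[symmetric] feas by auto
  \<comment> \<open>The endpoint bound gives \<open>dist_X\<close> at most \<open>1 + \<eta>\<close>
    times the norm, so a decrease by \<open>a / 2\<close> per unit of norm is a decrease by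
    \<open>b\<close> per unit of distance.\<close>
  define b where "b = a / (2 * (1 + \<eta>))"
  have b: "b > 0" using a \<eta> by (simp add: b_def)
  have slope: "\<exists>x'\<in>A. x' \<noteq> x \<and> ?d x' x < e \<and> \<phi> x' \<le> \<phi> x - b * ?d x' x"
    if x: "x \<in> A" "\<phi> x \<noteq> 0" and e: "e > 0" for x e
  proof -
    obtain xs h where "\<forall>n. xs n \<in> A \<and> xs n \<noteq> x" and xs0: "(\<lambda>n. ?d (xs n) x) \<longlonglongrightarrow> 0"
      and "\<forall>n. norm (xs n T - x T) \<le> \<eta> * ?N (xs n) x"
      and h: "Lp_tendsto p T (\<lambda>n t. (xs n t - x t) /\<^sub>R ?N (xs n) x) h"
      and desc: "descent_condition p T l g a x h"
      using ex[OF x] by (elim exE conjE)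
    then have xsA: "xs n \<in> A" and xsne: "xs n \<noteq> x"
      and end_le: "norm (xs n T - x T) \<le> \<eta> * ?N (xs n) x" for n by simp_all
    \<comment> \<open>The given sequence is only known to converge in \<open>dist_X\<close>.
      Compactness provides a subsequence that also converges pointwise, and uniqueness of limits in
      \<open>dist_X\<close> identifies its limit with \<open>x\<close>.\<close>
    obtain y r where y: "y \<in> A" and r: "strict_mono r" and lim: "(\<lambda>n. ?d (xs (r n)) y) \<longlonglongrightarrow> 0"
      and pw: "\<forall>t\<in>{0..T}. (\<lambda>n. xs (r n) t) \<longlonglongrightarrow> y t"
      using comp[of xs, OF xsA] by (elim bexE exE conjE)
    have limx: "(\<lambda>n. ?d (xs (r n)) x) \<longlonglongrightarrow> 0"
      using LIMSEQ_subseq_LIMSEQ[OF xs0 r] by (simp only: o_def)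
    have "?d y x \<le> ?d (xs (r n)) y + ?d (xs (r n)) x" for n
      using tri[OF y xsA x(1), of "r n"] sym[of y "xs (r n)"] by simp
    moreover have "(\<lambda>n. ?d (xs (r n)) y + ?d (xs (r n)) x) \<longlonglongrightarrow> 0 + 0"
      by (rule tendsto_add[OF lim limx])
    ultimately have "?d y x \<le> 0" using LIMSEQ_le_const by fastforce
    then have "y = x" using pos[OF y x(1)] by force
    define X where "X = (\<lambda>n. xs (r n))"
    define q where "q = (\<lambda>n. ?N (X n) x)"
    have XA: "X n \<in> A" for n using xsA by (simp add: X_def)
    have q_pos: "q n > 0" for n unfolding q_def X_def by (rule N_pos[OF xsA x(1) xsne])
    have q_lim: "q \<longlonglongrightarrow> 0"
      by (rule tendsto_sandwich[OF _ _ tendsto_const limx])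
         (use less_imp_le[OF q_pos] N_le in \<open>auto simp: q_def X_def intro!: always_eventually\<close>)
    have hX: "Lp_tendsto p T (\<lambda>n t. (X n t - x t) /\<^sub>R q n) h"
      using Lp_tendsto_subseq[OF h r] by (simp add: X_def q_def)
    have \<phi>pos: "penalty_term p T l g x > 0" using nonneg[OF x(1)] x(2) by (simp add: \<phi>_def)
    obtain m where m: "\<And>n. n \<ge> m \<Longrightarrow> ?d (X n) x < e"
      using order_tendstoD(2)[OF limx e] unfolding eventually_sequentially X_def by blast
    have "\<exists>n\<ge>m. penalty_term p T l g (X n) \<le> penalty_term p T l g x - a / 2 * q n"
    proof (cases "p = \<infinity>")
      case True
      show ?thesis
        unfolding True
      proof (rule slope_infinite_exponent[OF T C1])
        show "q n = Lp_norm \<infinity> T (\<lambda>t. X n t - x t)" for n by (simp add: q_def True)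
      qed (use cont[OF x(1)] cont[OF XA] q_pos q_lim hX \<phi>pos a desc True in simp_all)
    next
      case False
      show ?thesis
      proof (rule slope_finite_exponent[OF T p False C1, where R = R])
        show "(\<lambda>n. X n t) \<longlonglongrightarrow> x t" if "t \<in> {0..T}" for t
          using pw that \<open>y = x\<close> by (simp add: X_def)
      qed (use cont[OF x(1)] cont[OF XA] R[OF x(1)] R[OF XA] q_pos hX \<phi>pos a desc in simp_all)
    qed
    then obtain n where n: "n \<ge> m" "\<phi> (X n) \<le> \<phi> x - a / 2 * q n" unfolding \<phi>_def by (elim exE conjE)
    have "?d (X n) x \<le> (1 + \<eta>) * q n"
      using end_le[of "r n"] by (simp add: dist_X_def X_def q_def algebra_simps)
    then have "b * ?d (X n) x \<le> b * ((1 + \<eta>) * q n)" using b by (intro mult_left_mono) auto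
    also have "\<dots> = a / 2 * q n" using \<eta> by (simp add: b_def field_simps)
    finally have "\<phi> (X n) \<le> \<phi> x - b * ?d (X n) x" using n(2) by simp
    then show ?thesis using XA m[OF n(1)] xsne[of "r n"] by (intro bexI[of _ "X n"]) (simp_all add: X_def)
  qed
  have "completely_exact ?d A {x \<in> A. \<phi> x = 0} (cost T \<theta> \<zeta>) (\<lambda>c x. cost T \<theta> \<zeta> x + c * \<phi> x)"
  proof (rule completely_exact_of_slope[where b = b])
    show "\<exists>x\<in>A. \<exists>r. strict_mono r \<and> (\<lambda>n. ?d (s (r n)) x) \<longlonglongrightarrow> 0"
      if "\<And>n. s n \<in> A" for s :: "nat \<Rightarrow> real \<Rightarrow> real^'d"
      using comp[of s, OF that] by (elim bexE exE conjE) (intro bexI exI conjI)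
  qed (rule sym, (fact tri pos zero nonneg lip lipI b slope)+)
  moreover have "penalty_fun p T \<theta> \<zeta> l g = (\<lambda>c x. cost T \<theta> \<zeta> x + c * \<phi> x)"
    by (intro ext) (simp add: penalty_fun_def \<phi>_def)
  ultimately show ?thesis by (simp add: feas A_def[symmetric])
qed

end
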